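(* Let $G = (V, E)$ be a planar graph without isolated vertices and such that $\Delta(G) \leq 8$. Then $G$ contains at least $|V|/1460$ reducible edges.
   Context: For a vertex $v$, $d(v)$ denotes its degree; an $8$-neighbor of $x$ is a neighbor of degree $8$. An edge $xy$ is called $x$-weak if $x$ has at most $8 - d(y) + [d(y) = 8]$ neighbors of degree $8$ (here $[d(y)=8]$ is $1$ if $d(y)=8$ and $0$ otherwise); $xy$ is weak if it is $x$-weak or $y$-weak. A butterfly is a subgraph $B \subseteq G$ of one of the following two forms. Form $B_1$: $V(B)$ consists of distinct vertices $x, y, z, v_1, v_2, v_3$; $E(B)$ consists of the edges $xy, xz, yv_1, yv_3, zv_1, zv_2$, and $xv_i$ for $i \in \{1,2,3\}$; and $d_G(y) = d_G(z) = 3$, $d_G(x) = 8$, $d_G(v_i) = 8$ for $i \in \{1,2,3\}$. Form $B_2$: $V(B)$ consists of distinct vertices $x, y, z, v_1, v_2, v_3, v_4$; $E(B)$ consists of the edges $xy, xz, yv_1, yv_4, zv_2, zv_3$, and $xv_i$ for $i \in \{1,2,3,4\}$; and $d_G(y) = d_G(z) = 3$, $d_G(x) = 8$, $d_G(v_i) = 8$ for $i \in \{1,2,3,4\}$. For such a butterfly, the edge $xy$ is called butterfly-like. An edge is called reducible if it is weak or butterfly-like. *)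

theory Defs
  imports "HOL-Analysis.Analysis"
begin

definition simple_graph :: "'a set \<Rightarrow> 'a set set \<Rightarrow> bool" where
  "simple_graph V E \<longleftrightarrow> finite V \<and> (\<forall>e\<in>E. \<exists>u v. e = {u, v} \<and> u \<noteq> v \<and> u \<in> V \<and> v \<in> V)"

definition degree :: "'a set \<Rightarrow> 'a set set \<Rightarrow> 'a \<Rightarrow> nat" where
  "degree V E v = card {u \<in> V. {u, v} \<in> E}"

definition planar :: "'a set \<Rightarrow> 'a set set \<Rightarrow> bool" where
  "planar V E \<longleftrightarrow>
    (\<exists>(pos :: 'a \<Rightarrow> real^2) (c :: 'a set \<Rightarrow> real \<Rightarrow> real^2).
       inj_on pos V \<and>
       (\<forall>u v. {u, v} \<in> E \<longrightarrow>
          arc (c {u, v}) \<and> {pathstart (c {u, v}), pathfinish (c {u, v})} = {pos u, pos v} \<and>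
          path_image (c {u, v}) \<inter> pos ` V = {pos u, pos v}) \<and>
       (\<forall>e\<in>E. \<forall>e'\<in>E. e \<noteq> e' \<longrightarrow> path_image (c e) \<inter> path_image (c e') \<subseteq> pos ` (e \<inter> e')))"

definition num8nbrs :: "'a set \<Rightarrow> 'a set set \<Rightarrow> 'a \<Rightarrow> nat" where
  "num8nbrs V E x = card {u \<in> V. {u, x} \<in> E \<and> degree V E u = 8}"

definition x_weak :: "'a set \<Rightarrow> 'a set set \<Rightarrow> 'a \<Rightarrow> 'a \<Rightarrow> bool" where
  "x_weak V E x y \<longleftrightarrow>
     int (num8nbrs V E x) \<le> 8 - int (degree V E y) + (if degree V E y = 8 then 1 else 0)"

definition weak_edge :: "'a set \<Rightarrow> 'a set set \<Rightarrow> 'a \<Rightarrow> 'a \<Rightarrow> bool" where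
  "weak_edge V E x y \<longleftrightarrow> x_weak V E x y \<or> x_weak V E y x"

definition butterfly1 :: "'a set \<Rightarrow> 'a set set \<Rightarrow> 'a \<Rightarrow> 'a \<Rightarrow> 'a \<Rightarrow> 'a \<Rightarrow> 'a \<Rightarrow> 'a \<Rightarrow> bool" where
  "butterfly1 V E x y z v1 v2 v3 \<longleftrightarrow>
     distinct [x, y, z, v1, v2, v3] \<and> {x, y, z, v1, v2, v3} \<subseteq> V \<and>
     {{x, y}, {x, z}, {y, v1}, {y, v3}, {z, v1}, {z, v2}, {x, v1}, {x, v2}, {x, v3}} \<subseteq> E \<and>
     degree V E y = 3 \<and> degree V E z = 3 \<and> degree V E x = 8 \<and>
     degree V E v1 = 8 \<and> degree V E v2 = 8 \<and> degree V E v3 = 8"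

definition butterfly2 :: "'a set \<Rightarrow> 'a set set \<Rightarrow> 'a \<Rightarrow> 'a \<Rightarrow> 'a \<Rightarrow> 'a \<Rightarrow> 'a \<Rightarrow> 'a \<Rightarrow> 'a \<Rightarrow> bool" where
  "butterfly2 V E x y z v1 v2 v3 v4 \<longleftrightarrow>
     distinct [x, y, z, v1, v2, v3, v4] \<and> {x, y, z, v1, v2, v3, v4} \<subseteq> V \<and>
     {{x, y}, {x, z}, {y, v1}, {y, v4}, {z, v2}, {z, v3}, {x, v1}, {x, v2}, {x, v3}, {x, v4}} \<subseteq> E \<and>
     degree V E y = 3 \<and> degree V E z = 3 \<and> degree V E x = 8 \<and>
     degree V E v1 = 8 \<and> degree V E v2 = 8 \<and> degree V E v3 = 8 \<and> degree V E v4 = 8"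

definition butterfly_like :: "'a set \<Rightarrow> 'a set set \<Rightarrow> 'a \<Rightarrow> 'a \<Rightarrow> bool" where
  "butterfly_like V E x y \<longleftrightarrow>
     (\<exists>z v1 v2 v3. butterfly1 V E x y z v1 v2 v3) \<or>
     (\<exists>z v1 v2 v3 v4. butterfly2 V E x y z v1 v2 v3 v4)"

definition reducible_edge :: "'a set \<Rightarrow> 'a set set \<Rightarrow> 'a set \<Rightarrow> bool" where
  "reducible_edge V E e \<longleftrightarrow> e \<in> E \<and>
     (\<exists>x y. e = {x, y} \<and> (weak_edge V E x y \<or> butterfly_like V E x y))"

end

theory Submission
  imports Defs
begin

text \<open>Faces of a drawing are the connected components of its complement. By Janiszewski's theorem an arc
joining two different pieces of the drawing creates no face, and by the Jordan curve theorem an arc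
joining two points of the same piece creates exactly one. This gives Euler's inequality and shows that
every edge borders at most two faces. Calling an edge good when it borders exactly two faces and both
are triangles, the number of edges that are not good is at most \<open>4 (3 |V| - 6 - |E|)\<close>.

Give a vertex of degree \<open>k\<close> the charge \<open>10 (k - 6)\<close> and let charge flow from vertices of degree 6, 7, 8
to neighbors of smaller degree along edges that are not weak. Away from reducible edges every charge
becomes nonnegative, and it becomes positive except at vertices of degree 2 or 3 and at vertices of
degree 8 with a 2-neighbor or two 3-neighbors. Such an 8-vertex is incident to a butterfly-like edge, or
some neighbor of degree at most 3 lies on an edge that is not good. Since the total charge is at
most \<open>- 5\<close> times the number of edges that are not good, the vertices of positive charge and the edges
that are not good are together bounded by a multiple of the number of reducible edges, and every
vertex is within bounded distance of one of these objects.\<close>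

section \<open>Adding an arc to a plane set\<close>

text \<open>A connected set that meets \<open>F\<close> and also leaves it must cross
  \<open>frontier F\<close>, so the frontier condition forces maximality. The criterion sees
  \<open>D\<close> only through two local conditions, which later allows a face to be recognized in
  a smaller drawing.\<close>

lemma components_Compl_eq:
  fixes D :: "'a::real_normed_vector set"
  assumes "closed D"
  shows "F \<in> components (- D) \<longleftrightarrow> F \<noteq> {} \<and> open F \<and> connected F \<and> F \<inter> D = {} \<and> frontier F \<subseteq> D"
proof
  assume F: "F \<in> components (- D)"
  then show "F \<noteq> {} \<and> open F \<and> connected F \<and> F \<inter> D = {} \<and> frontier F \<subseteq> D"
    using frontier_of_components_closed_complement[OF assms F] in_components_nonempty[OF F]
      in_components_connected[OF F] in_components_subset[OF F]
      open_components[OF open_Compl[OF assms] F] by auto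
next
  assume R: "F \<noteq> {} \<and> open F \<and> connected F \<and> F \<inter> D = {} \<and> frontier F \<subseteq> D"
  show "F \<in> components (- D)"
    unfolding in_components_maximal
  proof (intro conjI allI impI)
    fix C assume C: "C \<noteq> {} \<and> F \<subseteq> C \<and> C \<subseteq> - D \<and> connected C"
    then have "C \<inter> frontier F = {}" using R by blast
    then show "C = F"
      using connected_Int_frontier[of C F] C R by blast
  qed (use R in auto)
qed

text \<open>Deleting part of one component leaves the others intact, so inserting an edge has to be
  studied only inside the face that contains it.\<close>

lemma components_diff_in_component:
  assumes "U \<in> components X" "A \<subseteq> U"
  shows "components (X - A) = (components X - {U}) \<union> components (U - A)"
proof -
  have UX: "U \<subseteq> X" using in_components_subset[OF assms(1)] .
  have sub: "C \<in> components X - {U} \<or> C \<in> components (U - A)" if C: "C \<in> components (X - A)" for C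
  proof (cases "C \<inter> U = {}")
    case False
    have "C \<subseteq> U"
      using components_maximal[OF assms(1) in_components_connected[OF C]] in_components_subset[OF C] False
      by blast
    then have "C \<in> components (U - A)"
      using components_intermediate_subset[OF C, of "U - A"] in_components_subset[OF C] UX by blast
    then show ?thesis by simp
  next
    case True
    obtain W where W: "W \<in> components X" "C \<subseteq> W"
      using exists_component_superset[of C X] in_components_connected[OF C] in_components_subset[OF C]
        in_components_nonempty[OF C] by auto
    have "W \<inter> U = {}"
      using True W components_nonoverlap[OF W(1) assms(1)] in_components_nonempty[OF C] by blast
    then have "W \<subseteq> X - A" using assms(2) in_components_subset[OF W(1)] by blast
    then have "C = W"
      using components_maximal[OF C in_components_connected[OF W(1)]] W(2) in_components_nonempty[OF C]
      by blast
    then show ?thesis using W(1) \<open>W \<inter> U = {}\<close> in_components_nonempty[OF C] by auto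
  qed
  have "C \<in> components (X - A)" if C: "C \<in> components X - {U}" for C
  proof -
    have "C \<inter> U = {}" using C assms(1) components_nonoverlap[of C X U] by auto
    then show ?thesis
      using components_intermediate_subset[of C X "X - A"] C assms(2) in_components_subset[of C X] by auto
  qed
  moreover have "C \<in> components (X - A)" if C: "C \<in> components (U - A)" for C
    unfolding in_components_maximal
  proof (intro conjI allI impI)
    fix D assume D: "D \<noteq> {} \<and> C \<subseteq> D \<and> D \<subseteq> X - A \<and> connected D"
    have "C \<noteq> {}" "C \<subseteq> U - A" using in_components_nonempty[OF C] in_components_subset[OF C] by auto
    then have "D \<subseteq> U"
      using components_maximal[OF assms(1), of D] D by blast
    then have "D \<subseteq> C" using components_maximal[OF C, of D] D \<open>C \<noteq> {}\<close> by blast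
    then show "D = C" using D by simp
  next
    show "C \<noteq> {}" "connected C" using in_components_nonempty[OF C] in_components_connected[OF C] by auto
    show "C \<subseteq> X - A" using in_components_subset[OF C] UX by blast
  qed
  ultimately show ?thesis using sub by blast
qed

text \<open>Janiszewski's theorem is applied twice: the arc is joined first with \<open>K2\<close>
  and the result with \<open>K1\<close>. Each overlap has at most one point, hence is connected, and
  an arc alone does not separate the plane.\<close>

lemma bridge_arc_not_separating:
  fixes g :: "real \<Rightarrow> complex"
  assumes K: "compact K1" "compact K2" "K1 \<inter> K2 = {}"
    and g: "arc g" "path_image g \<inter> K1 \<subseteq> {a}" "path_image g \<inter> K2 \<subseteq> {b}"
    and cc: "connected_component (- (K1 \<union> K2)) p q" "p \<notin> path_image g" "q \<notin> path_image g"
  shows "connected_component (- (K1 \<union> K2 \<union> path_image g)) p q"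
proof -
  have single: "connected (path_image g \<inter> K1)" "connected (path_image g \<inter> K2)"
    using g(2,3) by (metis connected_empty connected_sing subset_singleton_iff)+
  have c1: "connected_component (- K1) p q" and c2: "connected_component (- K2) p q"
    using cc(1) connected_component_of_subset[of "- (K1 \<union> K2)" p q] by blast+
  have "connected (- path_image g)" using connected_arc_complement[OF g(1)] by simp
  then have cg: "connected_component (- path_image g) p q"
    using cc(2,3) unfolding connected_iff_connected_component by blast
  have s1: "connected_component (- (path_image g \<union> K2)) p q"
    by (rule Janiszewski)
      (use K compact_arc_image[OF g(1)] single cg c2 compact_imp_closed in auto)
  have "connected_component (- ((path_image g \<union> K2) \<union> K1)) p q"
  proof (rule Janiszewski)
    show "compact (path_image g \<union> K2)" using K compact_arc_image[OF g(1)] by auto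
    show "connected ((path_image g \<union> K2) \<inter> K1)"
      using single(1) K(3) by (simp add: Int_Un_distrib2 Int_Un_distrib Int_commute)
  qed (use K s1 c1 compact_imp_closed in auto)
  then show ?thesis by (simp add: Un_ac)
qed

text \<open>The inverse of the parametrization would embed a nonempty open set into the line,
  against invariance of dimension. Consequently an arc cannot use up a whole face.\<close>

lemma interior_arc_image:
  fixes g :: "real \<Rightarrow> 'a::euclidean_space"
  assumes "arc g" "2 \<le> DIM('a)"
  shows "interior (path_image g) = {}"
proof (rule ccontr)
  assume ne: "interior (path_image g) \<noteq> {}"
  obtain h where h: "homeomorphism {0..1} (path_image g) g h"
    using homeomorphism_arc[OF assms(1)] .
  have "continuous_on (interior (path_image g)) h"
    using homeomorphism_cont2[OF h] continuous_on_subset interior_subset by blast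
  moreover have "inj_on h (interior (path_image g))"
    using homeomorphism_apply2[OF h] interior_subset[of "path_image g"] by (metis inj_on_def subsetD)
  ultimately have "DIM('a) \<le> DIM(real)"
    using invariance_of_dimension[of "interior (path_image g)" h] ne by simp
  then show False using assms(2) by simp
qed

lemma components_bridge_arc:
  fixes g :: "real \<Rightarrow> complex"
  assumes K: "compact K1" "compact K2" "K1 \<inter> K2 = {}"
    and g: "arc g" "path_image g \<inter> K1 \<subseteq> {a}" "path_image g \<inter> K2 \<subseteq> {b}"
    and U: "U \<in> components (- (K1 \<union> K2))"
  shows "connected (U - path_image g)" "U - path_image g \<noteq> {}"
proof -
  have UD: "U \<subseteq> - (K1 \<union> K2)" "connected U" using U in_components_subset in_components_connected by blast+
  show "connected (U - path_image g)"
    unfolding connected_iff_connected_component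
  proof (intro ballI)
    fix p q assume pq: "p \<in> U - path_image g" "q \<in> U - path_image g"
    then have "connected_component (- (K1 \<union> K2)) p q"
      using UD unfolding connected_component_def by blast
    then have "connected_component (- (K1 \<union> K2 \<union> path_image g)) p q"
      using bridge_arc_not_separating[OF K g] pq by blast
    then obtain t where t: "connected t" "t \<subseteq> - (K1 \<union> K2 \<union> path_image g)" "p \<in> t" "q \<in> t"
      unfolding connected_component_def by blast
    then have "t \<subseteq> U" using components_maximal[OF U, of t] pq by blast
    then show "connected_component (U - path_image g) p q"
      using t unfolding connected_component_def by blast
  qed
  have "open U" using components_Compl_eq[of "K1 \<union> K2" U] U K compact_imp_closed by blast
  moreover have "interior (path_image g) = {}" using interior_arc_image[OF g(1)] by simp
  ultimately show "U - path_image g \<noteq> {}"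
    using in_components_nonempty[OF U] interior_maximal[of U "path_image g"] by blast
qed

text \<open>An arc in \<open>D\<close> between the ends of \<open>g\<close> closes \<open>g\<close>
  to a Jordan curve, and the two pieces of \<open>U\<close> are its traces inside and outside that
  curve.\<close>

lemma components_crosscut:
  fixes g :: "real \<Rightarrow> complex"
  assumes D: "compact D"
    and g: "arc g" "path_image g \<inter> D = {pathstart g, pathfinish g}"
    and pc: "path_component D (pathstart g) (pathfinish g)"
    and U: "U \<in> components (- D)" "path_image g - {pathstart g, pathfinish g} \<subseteq> U"
  shows "card (components (U - path_image g)) = 2"
proof -
  have ne: "pathstart g \<noteq> pathfinish g" using arc_distinct_ends[OF g(1)] by simp
  have UD: "U \<subseteq> - D" "connected U" "open U"
    using components_Compl_eq[of D U] U(1) D compact_imp_closed by blast+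
  obtain p0 where "path p0" "path_image p0 \<subseteq> D" "pathstart p0 = pathfinish g" "pathfinish p0 = pathstart g"
    using path_component_sym[OF pc] unfolding path_component_def by blast
  then obtain p where p: "arc p" "path_image p \<subseteq> D" "pathstart p = pathfinish g" "pathfinish p = pathstart g"
    using path_contains_arc[of p0 "pathfinish g" "pathstart g"] ne by (metis subset_trans)
  define c where "c = g +++ p"
  have pic: "path_image c = path_image g \<union> path_image p"
    unfolding c_def using p by (simp add: path_image_join)
  have "path_image g \<inter> path_image p \<subseteq> {pathstart g, pathstart p}" using g(2) p by auto
  then have sc: "simple_path c" "pathfinish c = pathstart c"
    unfolding c_def using simple_path_join_loop[OF g(1) p(1)] p by auto
  define I where "I = inside (path_image c)"
  define O' where "O' = outside (path_image c)"
  have op: "open I" "open O'" and con: "connected I" "connected O'" and disj: "I \<inter> O' = {}"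
    and un: "I \<union> O' = - path_image c" and fr: "frontier I = path_image c" "frontier O' = path_image c"
    unfolding I_def O'_def using Jordan_inside_outside[OF sc] by auto
  \<comment> \<open>The curve meets \<open>D\<close> exactly in the arc \<open>p\<close>. This
    connected overlap is what Janiszewski's theorem requires below.\<close>
  have "path_image g \<inter> D \<subseteq> path_image p"
    using g(2) p(3,4) pathstart_in_path_image[of p] pathfinish_in_path_image[of p] by simp
  then have Dc: "D \<inter> path_image c = path_image p"
    using pic p(2) by blast
  have side: "t \<subseteq> Q" if t: "connected t" "t \<inter> path_image c = {}" "t \<inter> Q \<noteq> {}" and Q: "Q = I \<or> Q = O'" for t Q
  proof -
    have "t \<subseteq> I \<union> O'" using t(2) un by blast
    then have "I \<inter> t = {} \<or> O' \<inter> t = {}" using connectedD[OF t(1) op] disj by blast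
    then show ?thesis using Q t(3) \<open>t \<subseteq> I \<union> O'\<close> by blast
  qed
  have conn: "connected (U \<inter> Q)" if Q: "Q = I \<or> Q = O'" for Q
    unfolding connected_iff_connected_component
  proof (intro ballI)
    fix x y assume xy: "x \<in> U \<inter> Q" "y \<in> U \<inter> Q"
    have Qc: "connected Q" "Q \<subseteq> - path_image c" using Q con un by auto
    have "connected_component (- (D \<union> path_image c)) x y"
    proof (rule Janiszewski[OF D])
      show "closed (path_image c)" using sc(1) by (rule closed_simple_path_image)
      show "connected (D \<inter> path_image c)" using Dc p(1) connected_arc_image by simp
      show "connected_component (- D) x y"
        unfolding connected_component_def using UD(1,2) xy by blast
      show "connected_component (- path_image c) x y"
        unfolding connected_component_def using Qc xy by blast
    qed
    then obtain t where t: "connected t" "t \<subseteq> - (D \<union> path_image c)" "x \<in> t" "y \<in> t"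
      unfolding connected_component_def by blast
    then have "t \<subseteq> U" using components_maximal[OF U(1), of t] xy by blast
    moreover have "t \<subseteq> Q" using side[OF t(1) _ _ Q] t(2,3) xy by blast
    ultimately show "connected_component (U \<inter> Q) x y"
      unfolding connected_component_def using t by blast
  qed
  \<comment> \<open>An interior point of \<open>g\<close> lies in the open set \<open>U\<close> and
    on the frontier of both sides, so \<open>U\<close> meets both sides.\<close>
  have "path_image g - {pathstart g, pathfinish g} \<noteq> {}"
    using nonempty_simple_path_endless[OF arc_imp_simple_path[OF g(1)]] .
  then obtain w where w: "w \<in> path_image g" "w \<in> U" using U(2) by blast
  have nonempty: "U \<inter> Q \<noteq> {}" if Q: "Q = I \<or> Q = O'" for Q
  proof -
    have "w \<in> frontier Q" using w(1) pic fr Q by blast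
    then have "w \<in> closure Q" by (simp add: frontier_def)
    then show ?thesis using w(2) open_Int_closure_eq_empty[OF UD(3), of Q] by blast
  qed
  have split: "U - path_image g = (U \<inter> I) \<union> (U \<inter> O')"
    using un pic p(2) UD(1) by blast
  have comp: "U \<inter> Q \<in> components (U - path_image g)" if Q: "Q = I \<or> Q = O'" for Q
    unfolding in_components_maximal
  proof (intro conjI allI impI)
    fix C assume C: "C \<noteq> {} \<and> U \<inter> Q \<subseteq> C \<and> C \<subseteq> U - path_image g \<and> connected C"
    then have "C \<inter> path_image c = {}" using split un by blast
    then have "C \<subseteq> Q" using side[of C Q] C Q nonempty[OF Q] by blast
    then show "C = U \<inter> Q" using C by blast
  next
    show "U \<inter> Q \<subseteq> U - path_image g" using split Q by blast
  qed (use conn[OF Q] nonempty[OF Q] in auto)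
  have "components (U - path_image g) = {U \<inter> I, U \<inter> O'}"
  proof
    show "components (U - path_image g) \<subseteq> {U \<inter> I, U \<inter> O'}"
    proof
      fix C assume C: "C \<in> components (U - path_image g)"
      have "C \<noteq> {}" "C \<subseteq> (U \<inter> I) \<union> (U \<inter> O')"
        using in_components_nonempty[OF C] in_components_subset[OF C] split by simp_all
      then have "C \<inter> (U \<inter> I) \<noteq> {} \<or> C \<inter> (U \<inter> O') \<noteq> {}" by blast
      then show "C \<in> {U \<inter> I, U \<inter> O'}"
        using components_nonoverlap[OF C comp[of I]] components_nonoverlap[OF C comp[of O']] by simp
    qed
  qed (use comp in auto)
  moreover have "U \<inter> I \<noteq> U \<inter> O'" using disj nonempty[of I] by blast
  ultimately show ?thesis by simp
qed

section \<open>Faces of plane drawings\<close>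

definition tri :: "'a \<Rightarrow> 'a \<Rightarrow> 'a \<Rightarrow> 'a set set" where
  "tri x y z = {{x, y}, {y, z}, {x, z}}"

lemma card_tri: "x \<noteq> y \<Longrightarrow> y \<noteq> z \<Longrightarrow> x \<noteq> z \<Longrightarrow> card (tri x y z) = 3"
  unfolding tri_def by (auto simp: doubleton_eq_iff card_insert_if)

definition nbrs :: "'a set \<Rightarrow> 'a set set \<Rightarrow> 'a \<Rightarrow> 'a set" where
  "nbrs V E y = {u \<in> V. {u, y} \<in> E}"

lemma Union_tri: "\<Union> (tri x y z) = {x, y, z}"
  unfolding tri_def by auto

lemma tri_third_vertex:
  assumes "{u, v} \<in> tri x y z" "x \<noteq> y" "y \<noteq> z" "x \<noteq> z"
  obtains w where "tri x y z = tri u v w" "w \<noteq> u" "w \<noteq> v" "u \<noteq> v"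
proof -
  have perm: "tri x y z = tri y x z" "tri x y z = tri y z x" "tri x y z = tri z y x"
    "tri x y z = tri x z y" "tri x y z = tri z x y"
    unfolding tri_def by (simp_all add: insert_commute)
  have "u = x \<and> v = y \<or> u = y \<and> v = x \<or> u = y \<and> v = z \<or> u = z \<and> v = y \<or> u = x \<and> v = z \<or> u = z \<and> v = x"
    using assms(1) unfolding tri_def by (auto simp: doubleton_eq_iff)
  then show ?thesis
    using that perm assms(2-4) by metis
qed

text \<open>The plane is \<open>complex\<close>, the type in which the Jordan curve theorem and
  Janiszewski's theorem are formulated. The ends of an arc are given as a set because edges are
  unordered.\<close>

locale drawing =
  fixes V :: "'a set" and E :: "'a set set"
    and pos :: "'a \<Rightarrow> complex" and c :: "'a set \<Rightarrow> real \<Rightarrow> complex"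
  assumes finite_V: "finite V"
    and edgeE: "e \<in> E \<Longrightarrow> \<exists>u v. e = {u, v} \<and> u \<noteq> v \<and> u \<in> V \<and> v \<in> V"
    and inj_pos: "inj_on pos V"
    and arc_c: "e \<in> E \<Longrightarrow> arc (c e)"
    and ends_c: "e \<in> E \<Longrightarrow> {pathstart (c e), pathfinish (c e)} = pos ` e"
    and vertices_c: "e \<in> E \<Longrightarrow> path_image (c e) \<inter> pos ` V = pos ` e"
    and crossing: "e \<in> E \<Longrightarrow> e' \<in> E \<Longrightarrow> e \<noteq> e' \<Longrightarrow> path_image (c e) \<inter> path_image (c e') \<subseteq> pos ` (e \<inter> e')"
begin

text \<open>All vertices stay in every subdrawing, even those isolated in \<open>S\<close>.
  Subdrawings thus differ only in their edges, which suits induction by inserting edges one at a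
  time.\<close>

definition pts :: "'a set set \<Rightarrow> complex set" where
  "pts S = pos ` V \<union> (\<Union>e\<in>S. path_image (c e))"

definition open_edge :: "'a set \<Rightarrow> complex set" where
  "open_edge e = path_image (c e) - pos ` e"

definition faces :: "'a set set \<Rightarrow> complex set set" where
  "faces S = components (- pts S)"

text \<open>The border is a set, so an edge with \<open>F\<close> on both sides is counted once. A
  single point of the open edge in the closure of \<open>F\<close> suffices for membership.\<close>

definition bd :: "'a set set \<Rightarrow> complex set \<Rightarrow> 'a set set" where
  "bd S F = {e \<in> S. open_edge e \<inter> closure F \<noteq> {}}"

lemma edge_subset: "e \<in> E \<Longrightarrow> e \<subseteq> V"
  using edgeE by blast

lemma finite_E: "finite E"
  using finite_V edge_subset by (meson PowI finite_Pow_iff finite_subset subsetI)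

lemma finite_S: "S \<subseteq> E \<Longrightarrow> finite S"
  using finite_E finite_subset by blast

lemma compact_subdrawing:
  assumes "W \<subseteq> V" "S \<subseteq> E"
  shows "compact (pos ` W \<union> (\<Union>e\<in>S. path_image (c e)))"
proof -
  have "compact (pos ` W)"
    using finite_subset[OF assms(1) finite_V] by (simp add: finite_imp_compact)
  moreover have "compact (path_image (c e))" if "e \<in> S" for e
    using compact_arc_image[OF arc_c] that assms(2) by blast
  then have "compact (\<Union>e\<in>S. path_image (c e))"
    using finite_S[OF assms(2)] compact_UN by blast
  ultimately show ?thesis by (rule compact_Un)
qed

lemma compact_pts: "S \<subseteq> E \<Longrightarrow> compact (pts S)"
  unfolding pts_def by (rule compact_subdrawing[OF subset_refl])

lemma closed_pts: "S \<subseteq> E \<Longrightarrow> closed (pts S)"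
  using compact_pts compact_imp_closed by blast

lemma pts_insert: "pts (insert e S) = pts S \<union> path_image (c e)"
  unfolding pts_def by blast

lemma pts_mono: "S \<subseteq> T \<Longrightarrow> pts S \<subseteq> pts T"
  unfolding pts_def by blast

lemma pos_edge_subset: "e \<in> E \<Longrightarrow> pos ` e \<subseteq> pts S"
  unfolding pts_def using edge_subset by blast

lemma pos_edge_image: "e \<in> E \<Longrightarrow> pos ` e \<subseteq> path_image (c e)"
  using vertices_c by blast

lemma path_image_eq_open_edge: "e \<in> E \<Longrightarrow> path_image (c e) = open_edge e \<union> pos ` e"
  unfolding open_edge_def using pos_edge_image by blast

lemma open_edge_pts:
  assumes "S \<subseteq> E" "e \<in> E" "e \<notin> S"
  shows "open_edge e \<inter> pts S = {}"
proof -
  have "path_image (c e) \<inter> path_image (c f) \<subseteq> pos ` e" if "f \<in> S" for f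
    using crossing[of e f] that assms by blast
  then show ?thesis unfolding open_edge_def pts_def using vertices_c[OF assms(2)] by blast
qed

lemma path_image_Int_pts:
  assumes "S \<subseteq> E" "e \<in> E" "e \<notin> S"
  shows "path_image (c e) \<inter> pts S = pos ` e"
  using open_edge_pts[OF assms] pos_edge_subset[OF assms(2), of S] path_image_eq_open_edge[OF assms(2)] by blast

lemma Compl_pts_insert: "e \<in> E \<Longrightarrow> - pts (insert e S) = - pts S - open_edge e"
  using path_image_eq_open_edge[of e] pos_edge_subset[of e S] unfolding pts_insert by blast

lemma open_edge_connected:
  assumes "e \<in> E" shows "connected (open_edge e)" "open_edge e \<noteq> {}"
  using connected_simple_path_endless[OF arc_imp_simple_path[OF arc_c[OF assms]]]
    nonempty_simple_path_endless[OF arc_imp_simple_path[OF arc_c[OF assms]]]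
  unfolding open_edge_def ends_c[OF assms, symmetric] by auto

lemma open_edge_in_face:
  assumes "S \<subseteq> E" "e \<in> E" "e \<notin> S"
  obtains U where "U \<in> faces S" "open_edge e \<subseteq> U"
proof -
  have "open_edge e \<subseteq> - pts S" using open_edge_pts[OF assms] by blast
  moreover have "- pts S \<noteq> {}" using open_edge_connected(2)[OF assms(2)] calculation by auto
  ultimately show ?thesis
    using exists_component_superset[of "open_edge e" "- pts S"] open_edge_connected(1)[OF assms(2)] that
    unfolding faces_def by auto
qed

lemma faces_insert:
  assumes "U \<in> faces S" "open_edge e \<subseteq> U" "e \<in> E"
  shows "faces (insert e S) = (faces S - {U}) \<union> components (U - open_edge e)"
  using components_diff_in_component[of U "- pts S" "open_edge e"] assms Compl_pts_insert[of e S]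
  unfolding faces_def by simp

lemma face_iff:
  assumes "S \<subseteq> E"
  shows "F \<in> faces S \<longleftrightarrow> F \<noteq> {} \<and> open F \<and> connected F \<and> F \<inter> pts S = {} \<and> frontier F \<subseteq> pts S"
  unfolding faces_def using components_Compl_eq[OF closed_pts[OF assms]] .

lemma faces_disjoint: "F \<in> faces S \<Longrightarrow> F' \<in> faces S \<Longrightarrow> F \<noteq> F' \<Longrightarrow> F \<inter> F' = {}"
  unfolding faces_def using components_nonoverlap by blast

lemma Union_faces: "\<Union> (faces S) = - pts S"
  unfolding faces_def by simp

lemma face_diff_open_edge:
  assumes "S \<subseteq> E" "e \<in> E" "U \<in> faces S"
  shows "U - open_edge e = U - path_image (c e)"
  using path_image_eq_open_edge[OF assms(2)] pos_edge_subset[OF assms(2), of S] face_iff[OF assms(1), of U] assms(3)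
  by blast

section \<open>Effect of one new edge on the faces\<close>

definition linked :: "'a set set \<Rightarrow> 'a \<Rightarrow> 'a \<Rightarrow> bool" where
  "linked S u v \<longleftrightarrow> path_component (pts S) (pos u) (pos v)"

lemma linked_ends:
  assumes "e \<in> E" "e = {u, v}" "linked S u v"
  shows "path_component (pts S) (pathstart (c e)) (pathfinish (c e))"
proof -
  have "{pathstart (c e), pathfinish (c e)} = {pos u, pos v}"
    using ends_c[OF assms(1)] assms(2) by simp
  then show ?thesis using assms(3) path_component_sym unfolding linked_def
    by (metis doubleton_eq_iff)
qed

lemma faces_split_linked:
  assumes "S \<subseteq> E" "e \<in> E" "e \<notin> S" "e = {u, v}" "linked S u v" "U \<in> faces S" "open_edge e \<subseteq> U"
  shows "card (components (U - open_edge e)) = 2"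
  unfolding face_diff_open_edge[OF assms(1,2,6)]
proof (rule components_crosscut)
  show "compact (pts S)" "arc (c e)" using compact_pts[OF assms(1)] arc_c[OF assms(2)] by auto
  show "path_image (c e) \<inter> pts S = {pathstart (c e), pathfinish (c e)}"
    using path_image_Int_pts[OF assms(1-3)] ends_c[OF assms(2)] by simp
  show "U \<in> components (- pts S)" using assms(6) unfolding faces_def .
  show "path_image (c e) - {pathstart (c e), pathfinish (c e)} \<subseteq> U"
    using assms(7) ends_c[OF assms(2)] unfolding open_edge_def by simp
  show "path_component (pts S) (pathstart (c e)) (pathfinish (c e))"
    using linked_ends[OF assms(2,4,5)] .
qed

text \<open>The decomposition into \<open>K1\<close> and \<open>K2\<close> is a parameter because
  two choices occur: a path component against the rest, and a single isolated vertex against the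
  rest.\<close>

lemma faces_split_bridge:
  assumes "S \<subseteq> E" "e \<in> E" "e \<notin> S" "e = {u, v}" "U \<in> faces S"
    and K: "compact K1" "compact K2" "K1 \<inter> K2 = {}" "K1 \<union> K2 = pts S" "pos u \<in> K1" "pos v \<in> K2"
  shows "components (U - open_edge e) = {U - open_edge e}"
proof -
  have "path_image (c e) \<inter> (K1 \<union> K2) = {pos u, pos v}"
    using path_image_Int_pts[OF assms(1-3)] K(4) assms(4) by simp
  then have "path_image (c e) \<inter> K1 \<subseteq> {pos u}" "path_image (c e) \<inter> K2 \<subseteq> {pos v}"
    using K by blast+
  then have "connected (U - path_image (c e))" "U - path_image (c e) \<noteq> {}"
    using components_bridge_arc[OF K(1-3) arc_c[OF assms(2)], of "pos u" "pos v" U] assms(5) K(4)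
    unfolding faces_def by auto
  then show ?thesis
    unfolding face_diff_open_edge[OF assms(1,2,5)] components_eq_sing_iff by simp
qed

text \<open>Each edge is path connected, so it lies wholly in \<open>K\<close> or misses it. Both
  parts are therefore finite unions of edges and points, hence compact, as
  \<open>faces_split_bridge\<close> requires.\<close>

lemma path_component_pts_split:
  fixes z :: complex
  assumes S: "S \<subseteq> E"
  defines "K \<equiv> path_component_set (pts S) z"
  shows "compact K" "compact (pts S - K)"
proof -
  have dich: "path_image (c f) \<subseteq> K \<or> path_image (c f) \<inter> K = {}" if f: "f \<in> S" for f
  proof (rule ccontr)
    assume neg: "\<not> ?thesis"
    then obtain x where x: "x \<in> path_image (c f)" "x \<in> K" by blast
    have "path_connected (path_image (c f))" "path_image (c f) \<subseteq> pts S"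
      using path_connected_path_image[OF arc_imp_path[OF arc_c]] f S unfolding pts_def by blast+
    then have "path_image (c f) \<subseteq> path_component_set (pts S) x"
      using path_component_maximal x(1) by blast
    also have "\<dots> = K" using x(2) path_component_eq unfolding K_def by blast
    finally show False using neg by blast
  qed
  have KD: "K \<subseteq> pts S" unfolding K_def by (rule path_component_subset)
  let ?part = "\<lambda>X. pos ` {w \<in> V. pos w \<in> X} \<union> (\<Union>f\<in>{f \<in> S. path_image (c f) \<subseteq> X}. path_image (c f))"
  have part: "?part X = X" if X: "X = K \<or> X = pts S - K" for X
  proof
    show "?part X \<subseteq> X" by blast
    show "X \<subseteq> ?part X"
    proof
      fix x assume x: "x \<in> X"
      then have "x \<in> pts S" using X KD by blast
      then consider w where "w \<in> V" "x = pos w" | f where "f \<in> S" "x \<in> path_image (c f)"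
        unfolding pts_def by blast
      then show "x \<in> ?part X"
      proof cases
        case 1 then show ?thesis using x by blast
      next
        case 2
        then have "path_image (c f) \<subseteq> pts S" unfolding pts_def by blast
        then have "path_image (c f) \<subseteq> X" using dich[OF 2(1)] X x 2(2) by blast
        then show ?thesis using 2 by blast
      qed
    qed
  qed
  have cmp: "compact (?part X)" for X
    by (rule compact_subdrawing) (use S in auto)
  show "compact K" using cmp[of K] part[of K] by simp
  show "compact (pts S - K)" using cmp[of "pts S - K"] part[of "pts S - K"] by simp
qed

lemma faces_split_unlinked:
  assumes "S \<subseteq> E" "e \<in> E" "e \<notin> S" "e = {u, v}" "\<not> linked S u v" "U \<in> faces S"
  shows "components (U - open_edge e) = {U - open_edge e}"
proof (rule faces_split_bridge[OF assms(1-4,6) path_component_pts_split[OF assms(1), of "pos u"]])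
  have "pos u \<in> pts S" "pos v \<in> pts S" using pos_edge_subset[OF assms(2), of S] assms(4) by auto
  then show "pos u \<in> path_component_set (pts S) (pos u)" "pos v \<in> pts S - path_component_set (pts S) (pos u)"
    using assms(5) path_component_refl unfolding linked_def by auto
qed (use path_component_subset in blast)+

lemma card_faces_split:
  assumes "S \<subseteq> E" "e \<in> E" "e \<notin> S" "U \<in> faces S" "open_edge e \<subseteq> U"
  shows "finite (components (U - open_edge e))" "card (components (U - open_edge e)) \<le> 2"
proof -
  obtain u v where "e = {u, v}" using edgeE[OF assms(2)] by blast
  then have *: "card (components (U - open_edge e)) = 2 \<or> card (components (U - open_edge e)) = 1"
    using faces_split_linked[OF assms(1-3) _ _ assms(4,5)] faces_split_unlinked[OF assms(1-3) _ _ assms(4)]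
    by (metis is_singletonI is_singleton_altdef)
  then show "card (components (U - open_edge e)) \<le> 2" by linarith
  show "finite (components (U - open_edge e))" using * card.infinite by fastforce
qed

section \<open>Pieces of a drawing and Euler's inequality\<close>

definition ncomp :: "'a set set \<Rightarrow> nat" where
  "ncomp S = card ((\<lambda>u. path_component_set (pts S) (pos u)) ` V)"

text \<open>Old pieces map onto new ones, and an edge between unlinked vertices identifies two of
  them, so at least one piece is lost.\<close>

lemma ncomp_insert:
  assumes "e \<in> E" "e = {u, v}"
  shows "ncomp (insert e S) + (if linked S u v then 0 else 1) \<le> ncomp S"
proof -
  \<comment> \<open>On an old piece, \<open>g\<close> returns the new piece that contains
    it.\<close>
  define g where "g X = (\<Union>x\<in>X. path_component_set (pts (insert e S)) x)" for X
  let ?p = "\<lambda>w. path_component_set (pts S) (pos w)"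
  let ?q = "\<lambda>w. path_component_set (pts (insert e S)) (pos w)"
  have sub: "pts S \<subseteq> pts (insert e S)" by (rule pts_mono) blast
  have uv: "u \<in> V" "v \<in> V" using edge_subset[OF assms(1)] assms(2) by auto
  have g: "g (?p w) = ?q w" if "w \<in> V" for w
  proof -
    have eq: "path_component_set (pts (insert e S)) x = ?q w" if "x \<in> ?p w" for x
    proof (rule path_component_eq)
      show "x \<in> ?q w" using that path_component_of_subset[OF sub, of "pos w" x] by simp
    qed
    have "pos w \<in> ?p w" using \<open>w \<in> V\<close> path_component_refl[of "pos w" "pts S"] unfolding pts_def by simp
    then show ?thesis unfolding g_def using eq by blast
  qed
  have img: "?q ` V = g ` (?p ` V)" using g by (simp add: image_image)
  have fin: "finite (?p ` V)" using finite_V by simp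
  show ?thesis
  proof (cases "linked S u v")
    case True
    then show ?thesis using card_image_le[OF fin, of g] unfolding ncomp_def img by simp
  next
    case False
    have "path_component (pts (insert e S)) (pos u) (pos v)"
    proof -
      have "path_connected (path_image (c e))" "pos u \<in> path_image (c e)" "pos v \<in> path_image (c e)"
        using path_connected_path_image[OF arc_imp_path[OF arc_c[OF assms(1)]]]
          pos_edge_image[OF assms(1)] assms(2) by auto
      then have "path_component (path_image (c e)) (pos u) (pos v)"
        unfolding path_connected_component by blast
      then show ?thesis using path_component_of_subset[of "path_image (c e)"] unfolding pts_insert by blast
    qed
    then have "?q v = ?q u" using path_component_eq[of "pos v" _ "pos u"] by simp
    then have "g (?p u) = g (?p v)" using g uv by simp
    moreover have "?p u \<noteq> ?p v"
      using False path_component_refl[of "pos v" "pts S"] uv unfolding linked_def pts_def by auto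
    ultimately have "\<not> inj_on g (?p ` V)" using uv unfolding inj_on_def by blast
    then have "card (g ` (?p ` V)) \<noteq> card (?p ` V)" using eq_card_imp_inj_on[OF fin] by blast
    then show ?thesis using False card_image_le[OF fin, of g] unfolding ncomp_def img by simp
  qed
qed

lemma faces_empty: "card (faces {}) = 1"
proof -
  have fin: "finite (pos ` V)" using finite_V by simp
  then have "connected (- (pos ` V))"
    using connected_open_delete_finite[of UNIV "pos ` V"] convex_connected[OF convex_UNIV]
    by (simp add: Compl_eq_Diff_UNIV)
  moreover have "- (pos ` V) \<noteq> {}"
    using fin infinite_UNIV_char_0[where 'a=complex] by (metis Compl_UNIV_eq double_complement)
  ultimately have "components (- (pos ` V)) = {- (pos ` V)}" by (simp only: components_eq_sing_iff simp_thms)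
  then show ?thesis unfolding faces_def pts_def by simp
qed

lemma ncomp_empty_le: "ncomp {} \<le> card V"
  unfolding ncomp_def using card_image_le[OF finite_V] .

lemma card_faces_insert:
  assumes "S \<subseteq> E" "e \<in> E" "e \<notin> S" "e = {u, v}" "finite (faces S)"
  shows "finite (faces (insert e S))"
    "card (faces (insert e S)) = card (faces S) + (if linked S u v then 1 else 0)"
proof -
  obtain U where U: "U \<in> faces S" "open_edge e \<subseteq> U" using open_edge_in_face[OF assms(1-3)] .
  note fi = faces_insert[OF U assms(2)]
  have fin: "finite (components (U - open_edge e))" using card_faces_split[OF assms(1-3) U] by simp
  then show "finite (faces (insert e S))" using fi assms(5) by simp
  have "F \<inter> C = {}" if "F \<in> faces S - {U}" "C \<in> components (U - open_edge e)" for F C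
    using faces_disjoint[of F S U] that U(1) in_components_subset[OF that(2)] by blast
  moreover have "C \<noteq> {}" if "C \<in> components (U - open_edge e)" for C
    using in_components_nonempty[OF that] .
  ultimately have disj: "(faces S - {U}) \<inter> components (U - open_edge e) = {}"
    by (metis Int_absorb disjoint_iff)
  have "card (faces (insert e S)) = card (faces S - {U}) + card (components (U - open_edge e))"
    unfolding fi using card_Un_disjoint[OF _ fin disj] assms(5) by simp
  moreover have "card (faces S - {U}) + 1 = card (faces S)"
    using assms(5) U(1) by (metis Suc_eq_plus1 card.remove)
  moreover have "card (components (U - open_edge e)) = (if linked S u v then 2 else 1)"
    using faces_split_linked[OF assms(1-4) _ U] faces_split_unlinked[OF assms(1-4) _ U(1)] by simp
  ultimately show "card (faces (insert e S)) = card (faces S) + (if linked S u v then 1 else 0)"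
    by (simp split: if_splits)
qed

text \<open>An edge inside one piece is paid for by a new face, an edge between two pieces by the
  drop of \<open>ncomp\<close>. The induction starts with one face and at most one piece per
  vertex.\<close>

lemma euler:
  assumes "S \<subseteq> E"
  shows "finite (faces S) \<and> card S + 1 + ncomp S \<le> card (faces S) + card V"
  using finite_S[OF assms] assms
proof (induction S rule: finite_induct)
  case empty
  have "finite (faces {})" using faces_empty by (metis card.infinite zero_neq_one)
  then show ?case using faces_empty ncomp_empty_le by simp
next
  case (insert e S)
  obtain u v where e: "e = {u, v}" using edgeE[of e] insert.prems by blast
  have IH: "finite (faces S)" "card S + 1 + ncomp S \<le> card (faces S) + card V"
    using insert.IH insert.prems by auto
  have S: "S \<subseteq> E" "e \<in> E" "e \<notin> S" using insert by auto
  show ?case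
    using card_faces_insert[OF S e IH(1)] ncomp_insert[OF S(2) e, of S] IH(2) insert.hyps
    by (cases "linked S u v") simp_all
qed

lemma finite_faces: "S \<subseteq> E \<Longrightarrow> finite (faces S)"
  using euler by blast

lemma euler_ineq:
  assumes "S \<subseteq> E" "V \<noteq> {}"
  shows "card S + 2 \<le> card (faces S) + card V"
proof -
  have "ncomp S \<noteq> 0" unfolding ncomp_def using assms(2) finite_V by simp
  then show ?thesis using euler[OF assms(1)] by linarith
qed

section \<open>Borders of faces\<close>

text \<open>Once \<open>e\<close> is deleted, its open edge lies in a single face \<open>U\<close>,
  which splits into at most two when \<open>e\<close> returns. Any other face is disjoint from the
  open set \<open>U\<close>, so its closure misses the open edge.\<close>

lemma edge_faces_le2:
  assumes "S \<subseteq> E" "e \<in> S"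
  shows "card {F \<in> faces S. e \<in> bd S F} \<le> 2"
proof -
  let ?S = "S - {e}"
  have S: "?S \<subseteq> E" "e \<in> E" "e \<notin> ?S" "insert e ?S = S" using assms by auto
  obtain U where U: "U \<in> faces ?S" "open_edge e \<subseteq> U" using open_edge_in_face[OF S(1-3)] .
  have fi: "faces S = (faces ?S - {U}) \<union> components (U - open_edge e)"
    using faces_insert[OF U S(2)] S(4) by simp
  have "open U" using face_iff[OF S(1)] U(1) by blast
  have "e \<notin> bd S F" if F: "F \<in> faces ?S - {U}" for F
  proof -
    have "U \<inter> F = {}" using faces_disjoint[of U ?S F] F U(1) by blast
    then have "U \<inter> closure F = {}" using open_Int_closure_eq_empty[OF \<open>open U\<close>] by blast
    then show ?thesis using U(2) unfolding bd_def by blast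
  qed
  then have "{F \<in> faces S. e \<in> bd S F} \<subseteq> components (U - open_edge e)" using fi by blast
  then show ?thesis
    using card_mono[OF card_faces_split(1)[OF S(1-3) U]] card_faces_split(2)[OF S(1-3) U] order_trans
    by metis
qed

text \<open>By \<open>face_iff\<close>, \<open>F\<close> stays a face as long as its frontier stays
  drawn, and the frontier consists of points of vertices and of border edges.\<close>

lemma face_subset_edges:
  assumes "S \<subseteq> E" "F \<in> faces S" "T \<subseteq> S" "bd S F \<subseteq> T"
  shows "F \<in> faces T"
proof -
  have F: "F \<noteq> {} \<and> open F \<and> connected F \<and> F \<inter> pts S = {} \<and> frontier F \<subseteq> pts S"
    using face_iff[OF assms(1)] assms(2) by blast
  have "frontier F \<subseteq> pts T"
  proof
    fix x assume x: "x \<in> frontier F"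
    then have cl: "x \<in> closure F" by (simp add: frontier_def)
    have "x \<in> pts S" using F x by blast
    then consider "x \<in> pos ` V" | e where "e \<in> S" "x \<in> path_image (c e)" unfolding pts_def by blast
    then show "x \<in> pts T"
    proof cases
      case 1 then show ?thesis unfolding pts_def by blast
    next
      case 2
      then have e: "e \<in> E" using assms(1) by blast
      show ?thesis
      proof (cases "x \<in> pos ` e")
        case True then show ?thesis using pos_edge_subset[OF e] by blast
      next
        case False
        then have "e \<in> bd S F" using 2 cl unfolding bd_def open_edge_def by blast
        then show ?thesis using assms(4) 2(2) unfolding pts_def by blast
      qed
    qed
  qed
  moreover have "F \<inter> pts T = {}" using F pts_mono[OF assms(3)] by blast
  ultimately show ?thesis using face_iff[of T F] F assms(1,3) by blast
qed

lemma edges_subset_if_pts_subset: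
  assumes "S \<subseteq> E" "T \<subseteq> E" "pts S \<subseteq> pts T"
  shows "S \<subseteq> T"
proof
  fix e assume e: "e \<in> S"
  show "e \<in> T"
  proof (rule ccontr)
    assume "e \<notin> T"
    then have "open_edge e \<inter> pts T = {}" using open_edge_pts[OF assms(2), of e] e assms(1) by blast
    moreover have "open_edge e \<subseteq> pts S" unfolding open_edge_def pts_def using e by blast
    ultimately show False using open_edge_connected(2)[of e] e assms by blast
  qed
qed

lemma edge_obtain:
  assumes "e \<in> E" "x \<in> e"
  obtains z where "e = {x, z}" "x \<noteq> z" "z \<in> V"
proof -
  obtain u v where uv: "e = {u, v}" "u \<noteq> v" "u \<in> V" "v \<in> V" using edgeE[OF assms(1)] by auto
  then have "x = u \<or> x = v" using assms(2) by simp
  then show ?thesis using uv that[of u] that[of v] by (auto simp: insert_commute)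
qed

section \<open>Drawings with few edges and short borders\<close>

text \<open>If each end of each edge lay on a second edge, continuing an edge at both ends would use
  up all three edges, and the two outer ends would have to coincide, closing a triangle.\<close>

lemma small_has_leaf:
  assumes S: "S \<subseteq> E" "card S \<le> 3" "S \<noteq> {}"
    and nt: "\<not> (\<exists>x y z. S = tri x y z)"
  shows "\<exists>e\<in>S. \<exists>u v. e = {u, v} \<and> u \<noteq> v \<and> (\<forall>f\<in>S. u \<in> f \<longrightarrow> f = e)"
proof (rule ccontr)
  assume no: "\<not> ?thesis"
  have other: "\<exists>f\<in>S. u \<in> f \<and> f \<noteq> e" if "e \<in> S" "e = {u, v}" "u \<noteq> v" for e u v
    using no that by blast
  obtain e where e0: "e \<in> S" using S(3) by blast
  note SE = subsetD[OF S(1)]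
  obtain x y where e: "e = {x, y}" "x \<noteq> y" using edgeE[OF SE[OF e0]] by auto
  obtain f where f: "f \<in> S" "x \<in> f" "f \<noteq> e" using other[OF e0 e] by auto
  obtain z where z: "f = {x, z}" "x \<noteq> z" using edge_obtain[OF SE[OF f(1)] f(2)] by auto
  have "e = {y, x}" "y \<noteq> x" using e by auto
  then obtain g where g: "g \<in> S" "y \<in> g" "g \<noteq> e" using other[OF e0] by auto
  obtain w where w: "g = {y, w}" "y \<noteq> w" using edge_obtain[OF SE[OF g(1)] g(2)] by auto
  have zy: "z \<noteq> y" using f(3) z e by auto
  have wx: "w \<noteq> x" using g(3) w e by (auto simp: insert_commute)
  have "card {e, f, g} = 3" unfolding e(1) z(1) w(1) using e(2) z(2) w(2) zy wx
    by (auto simp: doubleton_eq_iff card_insert_if)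
  moreover have "{e, f, g} \<subseteq> S" using e0 f(1) g(1) by simp
  ultimately have Seq: "S = {e, f, g}"
    using card_seteq[of S "{e, f, g}"] finite_S[OF S(1)] S(2) by simp
  have "f = {z, x}" "z \<noteq> x" using z by auto
  then obtain h where h: "h \<in> S" "z \<in> h" "h \<noteq> f" using other[OF f(1)] by auto
  have "h \<noteq> e" using h(2) e(1) z(2) zy by auto
  then have "h = g" using Seq h by simp
  then have "w = z" using h(2) w(1) zy by simp
  then have "S = tri x y z" unfolding tri_def Seq e(1) z(1) w(1) by auto
  then show False using nt by blast
qed

text \<open>Before the insertion \<open>pos u\<close> is a piece of its own, so the new edge is a
  bridge.\<close>

lemma faces_insert_leaf:
  assumes "S \<subseteq> E" "e \<in> E" "e \<notin> S" "e = {u, v}" "u \<noteq> v" "\<forall>f\<in>S. u \<notin> f" "card (faces S) = 1"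
  shows "card (faces (insert e S)) = 1"
proof -
  have uv: "u \<in> V" "v \<in> V" using edge_subset[OF assms(2)] assms(4) by auto
  let ?K = "pos ` (V - {u}) \<union> (\<Union>f\<in>S. path_image (c f))"
  obtain U where U: "U \<in> faces S" "open_edge e \<subseteq> U" using open_edge_in_face[OF assms(1-3)] .
  have nu: "pos u \<notin> path_image (c f)" if "f \<in> S" for f
  proof
    assume "pos u \<in> path_image (c f)"
    then have "pos u \<in> pos ` f" using vertices_c[of f] that assms(1) uv by blast
    then have "u \<in> f" using inj_pos uv edge_subset[of f] that assms(1) by (meson inj_on_image_mem_iff subsetD)
    then show False using assms(6) that by blast
  qed
  moreover have "pos u \<notin> pos ` (V - {u})" using inj_pos uv by (auto simp: inj_on_def)
  ultimately have disj: "{pos u} \<inter> ?K = {}" by blast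
  have cmp: "compact ?K" by (rule compact_subdrawing) (use assms(1) in auto)
  have eqK: "{pos u} \<union> ?K = pts S" unfolding pts_def using uv by blast
  have "components (U - open_edge e) = {U - open_edge e}"
    by (rule faces_split_bridge[OF assms(1-4) U(1) _ cmp disj eqK]) (use uv assms(5) in auto)
  moreover have "faces S = {U}" using assms(7) U(1) by (metis card_1_singletonE singletonD)
  ultimately show ?thesis using faces_insert[OF U assms(2)] by simp
qed

text \<open>Such a drawing is a forest: removing leaf edges one by one keeps the number of faces and
  ends with the empty drawing.\<close>

lemma small_one_face:
  assumes "S \<subseteq> E" "card S \<le> 3" "\<not> (\<exists>x y z. x \<noteq> y \<and> y \<noteq> z \<and> x \<noteq> z \<and> S = tri x y z)"
  shows "card (faces S) = 1"
  using assms
proof (induction "card S" arbitrary: S rule: less_induct)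
  case less
  show ?case
  proof (cases "S = {}")
    case True then show ?thesis using faces_empty by simp
  next
    case False
    have "\<not> (\<exists>x y z. S = tri x y z)"
    proof
      assume "\<exists>x y z. S = tri x y z"
      then obtain x y z where S: "S = tri x y z" by blast
      then have "{x, y} \<in> E" "{y, z} \<in> E" "{x, z} \<in> E" using less.prems(1) unfolding tri_def by auto
      then have "x \<noteq> y" "y \<noteq> z" "x \<noteq> z" using edgeE[of "{x, y}"] edgeE[of "{y, z}"] edgeE[of "{x, z}"] by auto
      then show False using S less.prems(3) by blast
    qed
    then obtain e u v where e: "e \<in> S" "e = {u, v}" "u \<noteq> v" "\<forall>f\<in>S. u \<in> f \<longrightarrow> f = e"
      using small_has_leaf[OF less.prems(1,2) False] by blast
    let ?S = "S - {e}"
    have cS: "card ?S < card S" using e(1) finite_S[OF less.prems(1)] by (meson card_Diff1_less)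
    have "\<not> (\<exists>x y z. x \<noteq> y \<and> y \<noteq> z \<and> x \<noteq> z \<and> ?S = tri x y z)"
      using cS less.prems(2) card_tri by fastforce
    moreover have "?S \<subseteq> E" "card ?S \<le> 3" using less.prems(1,2) cS by auto
    ultimately have "card (faces ?S) = 1" using less.hyps[OF cS] by simp
    moreover have "\<forall>f\<in>?S. u \<notin> f" "e \<in> E" "e \<notin> ?S" using e(1,4) less.prems(1) by auto
    ultimately have "card (faces (insert e ?S)) = 1"
      using faces_insert_leaf[of ?S e u v] e(2,3) \<open>?S \<subseteq> E\<close> by simp
    then show ?thesis using e(1) by (simp add: insert_absorb)
  qed
qed

text \<open>The border edges alone already have \<open>F\<close> as a face. If there were at most
  three of them and they formed no triangle, \<open>F\<close> would be the entire complement,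
  leaving no room for the remaining edges of \<open>S\<close>.\<close>

lemma bd_card:
  assumes S: "S \<subseteq> E" "4 \<le> card S" and F: "F \<in> faces S"
  shows "3 \<le> card (bd S F)"
    "card (bd S F) = 3 \<Longrightarrow> \<exists>x y z. x \<noteq> y \<and> y \<noteq> z \<and> x \<noteq> z \<and> bd S F = tri x y z"
proof -
  let ?T = "bd S F"
  have TS: "?T \<subseteq> S" unfolding bd_def by blast
  have FT: "F \<in> faces ?T" using face_subset_edges[OF S(1) F TS] by simp
  have tri: "\<exists>x y z. x \<noteq> y \<and> y \<noteq> z \<and> x \<noteq> z \<and> ?T = tri x y z" if "card ?T \<le> 3"
  proof (rule ccontr)
    assume "\<not> ?thesis"
    then have "card (faces ?T) = 1" using small_one_face[of ?T] that subset_trans[OF TS S(1)] by simp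
    then have "faces ?T = {F}" using FT by (metis card_1_singletonE singletonD)
    then have "F = - pts ?T" using Union_faces[of ?T] by simp
    moreover have "F \<subseteq> - pts S" using face_iff[OF S(1)] F by blast
    ultimately have "pts S \<subseteq> pts ?T" by blast
    then have "S \<subseteq> ?T" using edges_subset_if_pts_subset[of S ?T] S(1) TS by blast
    then have "S = ?T" using TS by blast
    then show False using that S(2) by simp
  qed
  then show "card ?T = 3 \<Longrightarrow> \<exists>x y z. x \<noteq> y \<and> y \<noteq> z \<and> x \<noteq> z \<and> ?T = tri x y z" by simp
  show "3 \<le> card ?T"
  proof (rule ccontr)
    assume lt: "\<not> 3 \<le> card ?T"
    then obtain x y z where "x \<noteq> y" "y \<noteq> z" "x \<noteq> z" "?T = tri x y z" using tri by auto
    then have "card ?T = 3" using card_tri by simp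
    then show False using lt by simp
  qed
qed

text \<open>A path of two edges has one face, and the closing edge adds at most one.\<close>

lemma triangle_faces_le2:
  assumes "tri x y z \<subseteq> E" "x \<noteq> y" "y \<noteq> z" "x \<noteq> z"
  shows "card (faces (tri x y z)) \<le> 2"
proof -
  let ?S = "{{y, z}, {x, z}}"
  have ins: "tri x y z = insert {x, y} ?S" unfolding tri_def by blast
  have S: "?S \<subseteq> E" "{x, y} \<in> E" "{x, y} \<notin> ?S"
    using assms unfolding tri_def by (auto simp: doubleton_eq_iff)
  have c2: "card ?S \<le> 2" by (simp add: card_insert_if)
  have "\<not> (\<exists>a b d. a \<noteq> b \<and> b \<noteq> d \<and> a \<noteq> d \<and> ?S = tri a b d)"
    using c2 card_tri by fastforce
  then have one: "card (faces ?S) = 1" using small_one_face[OF S(1)] c2 by simp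
  have "card (faces (insert {x, y} ?S)) \<le> 2"
    using card_faces_insert(2)[OF S refl finite_faces[OF S(1)]] one by (simp split: if_splits)
  then show ?thesis using ins by simp
qed

text \<open>Two different faces with the same triangular border would fill the complement of the
  triangle, so a fourth edge could not be drawn.\<close>

lemma bd_triangle_unique:
  assumes S: "S \<subseteq> E" "4 \<le> card S" and F: "F \<in> faces S" "F' \<in> faces S"
    and T: "bd S F = tri x y z" "bd S F' = tri x y z" "x \<noteq> y" "y \<noteq> z" "x \<noteq> z"
  shows "F = F'"
proof (rule ccontr)
  assume ne: "F \<noteq> F'"
  let ?T = "tri x y z"
  have TS: "?T \<subseteq> S" using T(1) unfolding bd_def by blast
  then have TE: "?T \<subseteq> E" using S(1) by blast
  have "F \<in> faces ?T" "F' \<in> faces ?T" using face_subset_edges[OF S(1) _ TS] F T by auto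
  then have "faces ?T = {F, F'}"
    using card_seteq[of "faces ?T" "{F, F'}"] finite_faces[OF TE] triangle_faces_le2[OF TE T(3-5)] ne by simp
  then have "- pts ?T = F \<union> F'" using Union_faces[of ?T] by simp
  also have "\<dots> \<subseteq> - pts S" using face_iff[OF S(1)] F by blast
  finally have "S \<subseteq> ?T" using edges_subset_if_pts_subset[OF S(1) TE] by blast
  then have "card S \<le> card ?T" using finite_S[OF TE] card_mono by blast
  also have "card ?T = 3" using card_tri[OF T(3-5)] .
  finally show False using S(2) by simp
qed

lemma sum_bd:
  assumes "S \<subseteq> E"
  shows "(\<Sum>F\<in>faces S. card (bd S F)) = (\<Sum>e\<in>S. card {F \<in> faces S. e \<in> bd S F})"
proof -
  have "bd S F = {e \<in> S. e \<in> bd S F}" for F unfolding bd_def by blast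
  then have "(\<Sum>F\<in>faces S. card (bd S F)) = (\<Sum>F\<in>faces S. card {e \<in> S. e \<in> bd S F})" by simp
  also have "\<dots> = (\<Sum>e\<in>S. card {F \<in> faces S. e \<in> bd S F})"
    using sum_multicount_gen[OF finite_faces[OF assms] finite_S[OF assms],
        of "\<lambda>F e. e \<in> bd S F" "\<lambda>e. card {F \<in> faces S. e \<in> bd S F}"] by simp
  finally show ?thesis .
qed

lemma three_faces_le:
  assumes "S \<subseteq> E" "4 \<le> card S"
  shows "3 * card (faces S) \<le> 2 * card S"
proof -
  have "(\<Sum>F\<in>faces S. 3) \<le> (\<Sum>F\<in>faces S. card (bd S F))"
    using bd_card(1)[OF assms] by (intro sum_mono) simp
  also have "\<dots> \<le> (\<Sum>e\<in>S. 2)"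
    unfolding sum_bd[OF assms(1)] using edge_faces_le2[OF assms(1)] by (intro sum_mono) simp
  finally show ?thesis by simp
qed

section \<open>Good edges and their triangles\<close>

definition good :: "'a set \<Rightarrow> bool" where
  "good e \<longleftrightarrow> card {F \<in> faces E. e \<in> bd E F} = 2 \<and> (\<forall>F\<in>faces E. e \<in> bd E F \<longrightarrow> card (bd E F) = 3)"

text \<open>With \<open>b\<close> edges that are not good and \<open>f\<close> faces, the local
  estimates yield \<open>b + 12 * f \<le> 8 * card E\<close>. Twelve times Euler's inequality then
  eliminates \<open>f\<close>.\<close>

lemma card_not_good:
  assumes "4 \<le> card E"
  shows "card {e \<in> E. \<not> good e} + 4 * card E + 24 \<le> 12 * card V"
proof -
  let ?n = "\<lambda>e. card {F \<in> faces E. e \<in> bd E F}"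
  let ?big = "{F \<in> faces E. 4 \<le> card (bd E F)}"
  have fin: "finite (faces E)" "finite E" using finite_faces finite_E by auto
  have "V \<noteq> {}" using assms edgeE by force
  then have eul: "card E + 2 \<le> card (faces E) + card V" using euler_ineq by simp
  \<comment> \<open>An edge that is not good either borders at most one face, which leaves a slack
    of 4, or borders two faces of which one is not a triangle and is counted on the right.\<close>
  have e: "of_bool (\<not> good e) + 4 * ?n e \<le> 8 + card {F \<in> ?big. e \<in> bd E F}" if "e \<in> E" for e
  proof -
    have le: "?n e \<le> 2" using edge_faces_le2[of E e] that by simp
    have "1 \<le> card {F \<in> ?big. e \<in> bd E F}" if g: "\<not> good e" "?n e = 2"
    proof -
      obtain F where "F \<in> faces E" "e \<in> bd E F" "card (bd E F) \<noteq> 3" using g unfolding good_def by blast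
      then have "F \<in> {F \<in> ?big. e \<in> bd E F}" using bd_card(1)[OF _ assms, of F] by auto
      then have "{F \<in> ?big. e \<in> bd E F} \<noteq> {}" by blast
      then show ?thesis using fin(1) by (simp add: Suc_le_eq card_gt_0_iff)
    qed
    then show ?thesis using le by (cases "good e"; cases "?n e = 2") auto
  qed
  have "card {e \<in> E. \<not> good e} + 4 * (\<Sum>e\<in>E. ?n e) = (\<Sum>e\<in>E. of_bool (\<not> good e) + 4 * ?n e)"
    using fin(2) by (simp add: sum.distrib sum_distrib_left Int_def)
  also have "\<dots> \<le> (\<Sum>e\<in>E. 8 + card {F \<in> ?big. e \<in> bd E F})" using e by (intro sum_mono) simp
  also have "\<dots> = 8 * card E + (\<Sum>e\<in>E. card {F \<in> ?big. e \<in> bd E F})" by (simp add: sum.distrib)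
  also have "(\<Sum>e\<in>E. card {F \<in> ?big. e \<in> bd E F}) = (\<Sum>F\<in>?big. card {e \<in> E. e \<in> bd E F})"
    using sum_multicount_gen[of E ?big "\<lambda>e F. e \<in> bd E F" "\<lambda>F. card {e \<in> E. e \<in> bd E F}"] fin by simp
  also have "\<dots> = (\<Sum>F\<in>faces E. if 4 \<le> card (bd E F) then card {e \<in> E. e \<in> bd E F} else 0)"
    using fin(1) by (simp add: sum.inter_filter)
  also have "\<dots> = (\<Sum>F\<in>faces E. if 4 \<le> card (bd E F) then card (bd E F) else 0)"
    by (rule sum.cong) (auto simp: bd_def intro!: arg_cong[where f = card])
  finally have 1: "card {e \<in> E. \<not> good e} + 4 * (\<Sum>F\<in>faces E. card (bd E F))
      \<le> 8 * card E + (\<Sum>F\<in>faces E. if 4 \<le> card (bd E F) then card (bd E F) else 0)"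
    using sum_bd[of E] by simp
  \<comment> \<open>A triangle gives equality, 0 + 12 = 4 * 3; a border with k edges, k at least 4,
    satisfies k + 12 <= 4k.\<close>
  have "(\<Sum>F\<in>faces E. (if 4 \<le> card (bd E F) then card (bd E F) else 0) + 12) \<le> (\<Sum>F\<in>faces E. 4 * card (bd E F))"
    using bd_card(1)[OF _ assms] by (intro sum_mono) fastforce
  then have "(\<Sum>F\<in>faces E. if 4 \<le> card (bd E F) then card (bd E F) else 0) + 12 * card (faces E)
      \<le> 4 * (\<Sum>F\<in>faces E. card (bd E F))"
    by (simp only: sum.distrib sum_constant sum_distrib_left) simp
  then show ?thesis using 1 eul by linarith
qed

text \<open>Each of the two faces at a good edge is bounded by a triangle through that edge, and
  \<open>bd_triangle_unique\<close> forces different third vertices.\<close>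

lemma good_edge_triangles:
  assumes "4 \<le> card E" "{y, x} \<in> E" "good {y, x}"
  shows "\<exists>w1 w2. w1 \<noteq> w2 \<and> (\<forall>w\<in>{w1, w2}. w \<noteq> x \<and> w \<in> V \<and> {w, y} \<in> E \<and> {x, w} \<in> E
           \<and> (\<exists>F\<in>faces E. bd E F = tri y x w))"
proof -
  have face: "\<exists>w. w \<noteq> x \<and> w \<noteq> y \<and> x \<noteq> y \<and> bd E F = tri y x w" if F: "F \<in> faces E" "{y, x} \<in> bd E F" for F
  proof -
    have "card (bd E F) = 3" using assms(3) F unfolding good_def by auto
    then obtain p q r where pqr: "p \<noteq> q" "q \<noteq> r" "p \<noteq> r" "bd E F = tri p q r"
      using bd_card(2)[OF subset_refl assms(1) F(1)] by blast
    obtain w where "tri p q r = tri y x w" "w \<noteq> y" "w \<noteq> x" "y \<noteq> x"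
      using tri_third_vertex[of y x p q r] F(2) pqr by metis
    then show ?thesis using pqr(4) by auto
  qed
  have "card {F \<in> faces E. {y, x} \<in> bd E F} = 2" using assms(3) unfolding good_def by blast
  then obtain F1 F2 where F12: "{F \<in> faces E. {y, x} \<in> bd E F} = {F1, F2}" "F1 \<noteq> F2"
    unfolding card_2_iff by blast
  then have F: "F1 \<in> faces E" "{y, x} \<in> bd E F1" "F2 \<in> faces E" "{y, x} \<in> bd E F2" by blast+
  obtain w1 where w1: "w1 \<noteq> x" "w1 \<noteq> y" "x \<noteq> y" "bd E F1 = tri y x w1" using face[OF F(1,2)] by blast
  obtain w2 where w2: "w2 \<noteq> x" "w2 \<noteq> y" "bd E F2 = tri y x w2" using face[OF F(3,4)] by blast
  have ne: "w1 \<noteq> w2"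
    using bd_triangle_unique[OF subset_refl assms(1) F(1,3) w1(4)] w1 w2 F12(2) by auto
  have edges: "w \<in> V \<and> {w, y} \<in> E \<and> {x, w} \<in> E" if "bd E F = tri y x w" for F w
  proof -
    have "tri y x w \<subseteq> E" using that unfolding bd_def by blast
    then have "{y, w} \<in> E" "{x, w} \<in> E" unfolding tri_def by auto
    then show ?thesis using edge_subset[of "{x, w}"] by (auto simp: insert_commute)
  qed
  show ?thesis
    using ne w1(1,4) w2(1,3) edges[OF w1(4)] edges[OF w2(3)] F(1,3)
    by (intro exI[of _ w1] exI[of _ w2]) auto
qed

text \<open>A good edge \<open>{y, x}\<close> would supply two distinct neighbors of
  \<open>y\<close> other than \<open>x\<close>, while at most \<open>a\<close> is available.\<close>

lemma two_vertex_not_good: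
  assumes "4 \<le> card E" "nbrs V E y = {x, a}"
  shows "\<exists>e\<in>E. y \<in> e \<and> \<not> good e"
proof (rule ccontr)
  assume "\<not> ?thesis"
  moreover have "x \<in> nbrs V E y" using assms(2) by simp
  then have xy: "{y, x} \<in> E" unfolding nbrs_def by (simp add: insert_commute)
  ultimately have "good {y, x}" by auto
  then obtain w1 w2 where w: "w1 \<noteq> w2" "\<forall>w\<in>{w1, w2}. w \<noteq> x \<and> w \<in> V \<and> {w, y} \<in> E"
    using good_edge_triangles[OF assms(1) xy] by blast
  then have "w1 \<in> nbrs V E y" "w2 \<in> nbrs V E y" unfolding nbrs_def by auto
  then show False using w assms(2) by auto
qed

text \<open>The third vertices of the two triangles on \<open>{y, x}\<close> are distinct neighbors
  of \<open>y\<close> other than \<open>x\<close>, hence exactly \<open>a\<close> and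
  \<open>b\<close>.\<close>

lemma good_at_three_vertex:
  assumes "4 \<le> card E" "nbrs V E y = {x, a, b}" "\<forall>e\<in>E. y \<in> e \<longrightarrow> good e" "w \<in> {a, b}"
  shows "{x, w} \<in> E \<and> (\<exists>F\<in>faces E. bd E F = tri y x w)"
proof -
  have "x \<in> nbrs V E y" using assms(2) by simp
  then have xy: "{y, x} \<in> E" unfolding nbrs_def by (simp add: insert_commute)
  then have "good {y, x}" using assms(3) by auto
  then obtain w1 w2 where w: "w1 \<noteq> w2" "\<forall>w\<in>{w1, w2}. w \<noteq> x \<and> w \<in> V \<and> {w, y} \<in> E \<and> {x, w} \<in> E
      \<and> (\<exists>F\<in>faces E. bd E F = tri y x w)"
    using good_edge_triangles[OF assms(1) xy] by blast
  then have "w1 \<in> nbrs V E y" "w2 \<in> nbrs V E y" unfolding nbrs_def by auto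
  then have "w \<in> {w1, w2}" using w assms(2,4) by auto
  then show ?thesis using w(2) by blast
qed

lemma good_three_vertex:
  assumes "4 \<le> card E" "nbrs V E y = {x, a, b}" "\<forall>e\<in>E. y \<in> e \<longrightarrow> good e"
  shows "{x, a} \<in> E" "{x, b} \<in> E" "{a, b} \<in> E"
    "\<forall>T\<in>{tri y x a, tri y x b, tri y a b}. \<exists>F\<in>faces E. bd E F = T"
proof -
  have "nbrs V E y = {a, x, b}" using assms(2) by blast
  note 1 = good_at_three_vertex[OF assms] and 2 = good_at_three_vertex[OF assms(1) this assms(3)]
  show "{x, a} \<in> E" "{x, b} \<in> E" "{a, b} \<in> E" using 1[of a] 1[of b] 2[of b] by auto
  show "\<forall>T\<in>{tri y x a, tri y x b, tri y a b}. \<exists>F\<in>faces E. bd E F = T"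
    using 1[of a] 1[of b] 2[of b] by auto
qed

text \<open>The five vertices span \<open>K\<^sub>5\<close> minus an edge, which has at most six faces; the six triangles at
\<open>y\<close> and \<open>z\<close> are already six faces, so the drawing has no further edges.\<close>

lemma good_twins:
  assumes E: "4 \<le> card E"
    and dist: "distinct [x, a, b, y, z]"
    and y: "nbrs V E y = {x, a, b}" "\<forall>e\<in>E. y \<in> e \<longrightarrow> good e"
    and z: "nbrs V E z = {x, a, b}" "\<forall>e\<in>E. z \<in> e \<longrightarrow> good e"
  shows "nbrs V E x \<subseteq> {a, b, y, z}"
proof -
  define Ts where "Ts = {tri y x a, tri y x b, tri y a b, tri z x a, tri z x b, tri z a b}"
  define K where "K = {{y, x}, {y, a}, {y, b}, {z, x}, {z, a}, {z, b}, {x, a}, {x, b}, {a, b}}"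
  have "\<forall>T\<in>Ts. \<exists>F\<in>faces E. bd E F = T"
    using good_three_vertex(4)[OF E y] good_three_vertex(4)[OF E z] unfolding Ts_def by simp
  then obtain G where G: "\<And>T. T \<in> Ts \<Longrightarrow> G T \<in> faces E \<and> bd E (G T) = T" by metis
  have "K = \<Union> Ts" unfolding K_def Ts_def tri_def by (auto simp: insert_commute)
  then have TK: "T \<subseteq> K" if "T \<in> Ts" for T using that by blast
  have KE: "K \<subseteq> E" unfolding \<open>K = \<Union> Ts\<close> using G unfolding bd_def by blast
  have cK: "card K = 9" unfolding K_def using dist by (auto simp: doubleton_eq_iff card_insert_if)
  \<comment> \<open>The value of \<open>h\<close> records which of \<open>y\<close>,
    \<open>z\<close> a triangle contains and which of \<open>x\<close>, \<open>a\<close>,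
    \<open>b\<close> it omits. It serves to show that the six triangles are distinct.\<close>
  define h where "h T = ({y, z} \<inter> \<Union> T, {x, a, b} - \<Union> T)" for T
  have h: "h (tri p q r) = ({y, z} \<inter> {p, q, r}, {x, a, b} - {p, q, r})" for p q r
    unfolding h_def Union_tri ..
  have "h (tri y x a) = ({y}, {b})" "h (tri y x b) = ({y}, {a})" "h (tri y a b) = ({y}, {x})"
    "h (tri z x a) = ({z}, {b})" "h (tri z x b) = ({z}, {a})" "h (tri z a b) = ({z}, {x})"
    unfolding h using dist by auto
  then have hT: "h ` Ts = {({y}, {b}), ({y}, {a}), ({y}, {x}), ({z}, {b}), ({z}, {a}), ({z}, {x})}"
    unfolding Ts_def by simp
  have "x \<noteq> a" "a \<noteq> b" "x \<noteq> b" "y \<noteq> z" using dist by auto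
  then have "card {({y}, {b}), ({y}, {a}), ({y}, {x}), ({z}, {b}), ({z}, {a}), ({z}, {x})} = 6"
    by (simp add: eq_commute[of a x])
  then have "6 = card (h ` Ts)" unfolding hT by (rule sym)
  also have "\<dots> \<le> card Ts" unfolding Ts_def by (intro card_image_le) simp
  finally have c6: "6 \<le> card Ts" .
  have "inj_on G Ts" using G by (metis inj_onI)
  then have "6 \<le> card (G ` Ts)" using c6 card_image by metis
  moreover have "card (faces K) \<le> 6" using three_faces_le[OF KE] cK by simp
  moreover have sub: "G ` Ts \<subseteq> faces K"
    using face_subset_edges[OF subset_refl _ KE] G TK by force
  ultimately have eq: "G ` Ts = faces K"
    using card_seteq[OF finite_faces[OF KE] sub] by linarith
  \<comment> \<open>The six faces cover the complement of \<open>pts K\<close> and avoid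
    \<open>pts E\<close>, so no edge outside \<open>K\<close> is drawn.\<close>
  have "- pts K = \<Union> (G ` Ts)" unfolding eq Union_faces ..
  also have "\<dots> \<subseteq> - pts E" using G Union_faces[of E] by blast
  finally have "E \<subseteq> K" using edges_subset_if_pts_subset[OF subset_refl KE] by blast
  show ?thesis
  proof
    fix u assume "u \<in> nbrs V E x"
    then have "{u, x} \<in> K" using \<open>E \<subseteq> K\<close> unfolding nbrs_def by blast
    then show "u \<in> {a, b, y, z}" using dist unfolding K_def by (auto simp: doubleton_eq_iff)
  qed
qed

end

section \<open>Combinatorial consequences of planarity\<close>

text \<open>The drawing is carried from \<open>real^2\<close> to \<open>complex\<close> by the
  linear map \<open>h\<close>; being injective, \<open>h\<close> preserves arcs and
  intersections.\<close>

lemma planar_imp_drawing: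
  assumes "simple_graph V E" "planar V E"
  shows "\<exists>pos c. drawing V E pos c"
proof -
  obtain pos :: "'a \<Rightarrow> real^2" and c where inj: "inj_on pos V"
    and edge: "\<And>u v. {u, v} \<in> E \<Longrightarrow> arc (c {u, v})
        \<and> {pathstart (c {u, v}), pathfinish (c {u, v})} = {pos u, pos v}
        \<and> path_image (c {u, v}) \<inter> pos ` V = {pos u, pos v}"
    and cross: "\<And>e e'. e \<in> E \<Longrightarrow> e' \<in> E \<Longrightarrow> e \<noteq> e' \<Longrightarrow>
        path_image (c e) \<inter> path_image (c e') \<subseteq> pos ` (e \<inter> e')"
    using assms(2) unfolding planar_def by metis
  define h :: "real^2 \<Rightarrow> complex" where "h p = Complex (p $ 1) (p $ 2)" for p
  have lin: "linear h" unfolding h_def by (rule linearI) (simp_all add: complex_eq_iff)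
  have injh: "inj h" unfolding h_def inj_def by (simp add: vec_eq_iff forall_2)
  have pim: "path_image (h \<circ> g) = h ` path_image g" for g by (simp add: path_image_compose)
  have Int: "h ` X \<inter> h ` Y = h ` (X \<inter> Y)" for X Y using image_Int[OF injh] by blast
  have simple: "\<exists>u v. e = {u, v} \<and> u \<noteq> v \<and> u \<in> V \<and> v \<in> V" if "e \<in> E" for e
    using assms(1) that unfolding simple_graph_def by simp
  have "drawing V E (h \<circ> pos) (\<lambda>e. h \<circ> c e)"
  proof
    show "finite V" using assms(1) unfolding simple_graph_def by simp
    show "inj_on (h \<circ> pos) V" using comp_inj_on[OF inj] injh inj_on_subset by blast
    fix e assume e: "e \<in> E"
    show "\<exists>u v. e = {u, v} \<and> u \<noteq> v \<and> u \<in> V \<and> v \<in> V" using simple[OF e] .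
    obtain u v where uv: "e = {u, v}" using simple[OF e] by auto
    have "arc (c e)" "{pathstart (c e), pathfinish (c e)} = pos ` e" "path_image (c e) \<inter> pos ` V = pos ` e"
      using edge[of u v] e unfolding uv by auto
    note ce = this
    show "arc (h \<circ> c e)" using ce(1) arc_linear_image_eq[OF lin injh] by blast
    have "{pathstart (h \<circ> c e), pathfinish (h \<circ> c e)} = h ` {pathstart (c e), pathfinish (c e)}"
      by (simp add: pathstart_compose pathfinish_compose)
    then show "{pathstart (h \<circ> c e), pathfinish (h \<circ> c e)} = (h \<circ> pos) ` e"
      unfolding ce(2) by (simp add: image_comp)
    show "path_image (h \<circ> c e) \<inter> (h \<circ> pos) ` V = (h \<circ> pos) ` e"
      unfolding pim image_comp[symmetric] Int ce(3) ..
    fix e' assume "e' \<in> E" "e \<noteq> e'"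
    then have "path_image (c e) \<inter> path_image (c e') \<subseteq> pos ` (e \<inter> e')" using cross e by blast
    then show "path_image (h \<circ> c e) \<inter> path_image (h \<circ> c e') \<subseteq> (h \<circ> pos) ` (e \<inter> e')"
      unfolding pim image_comp[symmetric] Int by (rule image_mono)
  qed
  then show ?thesis by blast
qed

text \<open>Here \<open>B\<close> consists of the edges that are not good. The five facts obtained
  are everything that the discharging uses about planarity.\<close>

lemma planar_defect_edges:
  assumes "simple_graph V E" "planar V E" "4 \<le> card E"
  obtains B where "B \<subseteq> E" "card B + 4 * card E + 24 \<le> 12 * card V"
    "\<And>y x a. nbrs V E y = {x, a} \<Longrightarrow> \<exists>e\<in>B. y \<in> e"
    "\<And>y x a b. nbrs V E y = {x, a, b} \<Longrightarrow> \<forall>e\<in>B. y \<notin> e \<Longrightarrow> {x, a} \<in> E \<and> {x, b} \<in> E \<and> {a, b} \<in> E"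
    "\<And>x a b y z. distinct [x, a, b, y, z] \<Longrightarrow> nbrs V E y = {x, a, b} \<Longrightarrow> nbrs V E z = {x, a, b}
      \<Longrightarrow> \<forall>e\<in>B. y \<notin> e \<and> z \<notin> e \<Longrightarrow> nbrs V E x \<subseteq> {a, b, y, z}"
proof -
  obtain pos c where "drawing V E pos c" using planar_imp_drawing[OF assms(1,2)] by blast
  then interpret drawing V E pos c .
  show ?thesis
  proof
    let ?B = "{e \<in> E. \<not> good e}"
    show "?B \<subseteq> E" by blast
    show "card ?B + 4 * card E + 24 \<le> 12 * card V" using card_not_good[OF assms(3)] .
    show "\<exists>e\<in>?B. y \<in> e" if "nbrs V E y = {x, a}" for y x a
      using two_vertex_not_good[OF assms(3)] that by blast
    show "{x, a} \<in> E \<and> {x, b} \<in> E \<and> {a, b} \<in> E"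
      if "nbrs V E y = {x, a, b}" "\<forall>e\<in>?B. y \<notin> e" for y x a b
      using good_three_vertex(1-3)[OF assms(3), of y x a b] that by blast
    show "nbrs V E x \<subseteq> {a, b, y, z}"
      if "distinct [x, a, b, y, z]" "nbrs V E y = {x, a, b}" "nbrs V E z = {x, a, b}"
        "\<forall>e\<in>?B. y \<notin> e \<and> z \<notin> e" for x a b y z
    proof -
      have "\<forall>e\<in>E. y \<in> e \<longrightarrow> good e" "\<forall>e\<in>E. z \<in> e \<longrightarrow> good e" using that(4) by blast+
      then show ?thesis using good_twins[OF assms(3) that(1)] that(2,3) by simp
    qed
  qed
qed

section \<open>Discharging\<close>

text \<open>An 8-vertex with a \<open>k\<close>-neighbor along an edge that is not weak has at most \<open>k - 1\<close> neighbors of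
degree below 8. Amounts \<open>20 / (k - 1)\<close> would exhaust its charge 20 exactly; for \<open>k \<ge> 4\<close> they are lowered so
that some charge remains.\<close>

definition transfer :: "nat \<Rightarrow> nat \<Rightarrow> int" where
  "transfer i j =
    (if i = 8 then
       (if j = 2 then 20 else if j = 3 then 10 else if j = 4 then 6
        else if j = 5 then 4 else if j = 6 then 2 else if j = 7 then 1 else 0)
     else if i = 7 then (if j = 3 then 10 else if j = 4 then 5 else if j = 5 then 1 else 0)
     else if i = 6 \<and> j = 4 then 4 else 0)"

definition strong :: "'a set \<Rightarrow> 'a set set \<Rightarrow> 'a \<Rightarrow> 'a set" where
  "strong V E v = {u \<in> nbrs V E v. \<not> weak_edge V E u v}"

text \<open>The sum is the net inflow. A strong edge enters the charges of its two ends with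
  opposite signs, so the transfers cancel in the total.\<close>

definition charge :: "'a set \<Rightarrow> 'a set set \<Rightarrow> 'a \<Rightarrow> int" where
  "charge V E v = 10 * (int (degree V E v) - 6)
     + (\<Sum>u\<in>strong V E v. transfer (degree V E u) (degree V E v) - transfer (degree V E v) (degree V E u))"

definition reducible_ends :: "'a set \<Rightarrow> 'a set set \<Rightarrow> 'a set" where
  "reducible_ends V E = {v \<in> V. \<exists>e\<in>E. reducible_edge V E e \<and> v \<in> e}"

lemma weak_edge_sym: "weak_edge V E u v \<longleftrightarrow> weak_edge V E v u"
  unfolding weak_edge_def by blast

lemma weak_imp_reducible: "{u, v} \<in> E \<Longrightarrow> weak_edge V E u v \<Longrightarrow> reducible_edge V E {u, v}"
  unfolding reducible_edge_def by blast

lemma strong_sym: "u \<in> V \<Longrightarrow> v \<in> V \<Longrightarrow> u \<in> strong V E v \<longleftrightarrow> v \<in> strong V E u"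
  unfolding strong_def nbrs_def using weak_edge_sym[of V E u v] by (simp add: insert_commute[of u v])

lemma degree_eq_card_nbrs: "degree V E v = card (nbrs V E v)"
  unfolding degree_def nbrs_def ..

lemma num8nbrs_eq: "num8nbrs V E v = card {u \<in> nbrs V E v. degree V E u = 8}"
  unfolding num8nbrs_def nbrs_def by (intro arg_cong[where f = card]) blast

section \<open>Degree counts and the total charge\<close>

locale degree8_graph =
  fixes V :: "'a set" and E :: "'a set set"
  assumes simple: "simple_graph V E"
    and deg_pos: "v \<in> V \<Longrightarrow> 1 \<le> degree V E v"
    and deg_le8: "v \<in> V \<Longrightarrow> degree V E v \<le> 8"
begin

abbreviation "d \<equiv> degree V E"
abbreviation "N \<equiv> nbrs V E"
abbreviation "n8 \<equiv> num8nbrs V E"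
abbreviation "D \<equiv> reducible_ends V E"

text \<open>Sorting strong neighbors by degree makes every charge a linear expression in these
  counts, so that the case analyses become linear arithmetic.\<close>

definition ns :: "'a \<Rightarrow> nat \<Rightarrow> nat" where
  "ns v j = card {u \<in> strong V E v. d u = j}"

lemma fin_V: "finite V"
  using simple unfolding simple_graph_def by simp

lemma edge_cases:
  assumes "e \<in> E"
  obtains u v where "e = {u, v}" "u \<noteq> v" "u \<in> V" "v \<in> V"
  using simple assms unfolding simple_graph_def by blast

lemma fin_E: "finite E"
proof (rule finite_subset)
  show "E \<subseteq> Pow V" by (auto elim!: edge_cases)
qed (use fin_V in simp)

lemma card_edge: "e \<in> E \<Longrightarrow> card e = 2"
  by (auto elim!: edge_cases)

lemma fin_N: "finite (N v)"
  unfolding nbrs_def using fin_V by simp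

lemma fin_strong: "finite (strong V E v)"
  unfolding strong_def using fin_N by simp

lemma nbrs_sym: "u \<in> N v \<Longrightarrow> v \<in> V \<Longrightarrow> v \<in> N u"
  unfolding nbrs_def by (simp add: insert_commute)

lemma nbrs_in: "u \<in> N v \<Longrightarrow> u \<in> V \<and> {u, v} \<in> E \<and> u \<noteq> v"
  unfolding nbrs_def using card_edge[of "{u, v}"] by auto

lemma edge_incident:
  assumes "v \<in> V"
  shows "card {e \<in> E. v \<in> e} = d v"
proof -
  have "bij_betw (\<lambda>u. {u, v}) (N v) {e \<in> E. v \<in> e}"
  proof (rule bij_betwI')
    fix x y assume "x \<in> N v" "y \<in> N v"
    then show "({x, v} = {y, v}) = (x = y)" using nbrs_in by (auto simp: doubleton_eq_iff)
  next
    fix x assume "x \<in> N v" then show "{x, v} \<in> {e \<in> E. v \<in> e}" using nbrs_in by auto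
  next
    fix e assume e: "e \<in> {e \<in> E. v \<in> e}"
    then obtain a b where "e = {a, b}" "a \<in> V" "b \<in> V" using edge_cases[of e] by blast
    moreover have "v = a \<or> v = b" using e calculation by auto
    ultimately show "\<exists>x\<in>N v. e = {x, v}" using e unfolding nbrs_def by (auto simp: insert_commute)
  qed
  then show ?thesis unfolding degree_eq_card_nbrs using bij_betw_same_card by metis
qed

lemma sum_degree: "(\<Sum>v\<in>V. d v) = 2 * card E"
proof -
  have "(\<Sum>v\<in>V. d v) = (\<Sum>v\<in>V. card {e \<in> E. v \<in> e})" using edge_incident by simp
  also have "\<dots> = (\<Sum>e\<in>E. card {v \<in> V. v \<in> e})"
    using sum_multicount_gen[OF fin_V fin_E, of "\<lambda>v e. v \<in> e" "\<lambda>e. card {v \<in> V. v \<in> e}"] by simp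
  also have "\<dots> = (\<Sum>e\<in>E. 2)"
  proof (rule sum.cong)
    fix e assume e: "e \<in> E"
    then have "{v \<in> V. v \<in> e} = e" by (auto elim!: edge_cases)
    then show "card {v \<in> V. v \<in> e} = 2" using card_edge[OF e] by simp
  qed simp
  finally show ?thesis by simp
qed

text \<open>Exchanging the two summations cancels the transfers, since being strong is symmetric.
  The initial charges are then evaluated by the handshake identity
  \<open>sum_degree\<close>.\<close>

lemma sum_charge: "(\<Sum>v\<in>V. charge V E v) = 20 * int (card E) - 60 * int (card V)"
proof -
  let ?t = "\<lambda>u v. transfer (d u) (d v)"
  let ?P = "\<lambda>u v. u \<in> strong V E v"
  have str: "strong V E v = {u \<in> V. ?P u v}" for v unfolding strong_def nbrs_def by blast
  have "(\<Sum>v\<in>V. \<Sum>u\<in>strong V E v. ?t u v) = (\<Sum>v\<in>V. \<Sum>u\<in>{u \<in> V. ?P u v}. ?t u v)"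
    using str by simp
  also have "\<dots> = (\<Sum>u\<in>V. \<Sum>v\<in>{v \<in> V. ?P u v}. ?t u v)"
    by (rule sum.swap_restrict[OF fin_V fin_V])
  also have "\<dots> = (\<Sum>u\<in>V. \<Sum>v\<in>strong V E u. ?t u v)"
  proof (rule sum.cong[OF refl])
    fix u assume "u \<in> V"
    then have "v \<in> {v \<in> V. ?P u v} \<longleftrightarrow> v \<in> strong V E u" for v
      using strong_sym[of u V v E] str[of u] by auto
    then have "{v \<in> V. ?P u v} = strong V E u" by (rule set_eqI)
    then show "(\<Sum>v\<in>{v \<in> V. ?P u v}. ?t u v) = (\<Sum>v\<in>strong V E u. ?t u v)" by simp
  qed
  finally have "(\<Sum>v\<in>V. \<Sum>u\<in>strong V E v. ?t u v - ?t v u) = 0" by (simp add: sum_subtractf)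
  then have "(\<Sum>v\<in>V. charge V E v) = (\<Sum>v\<in>V. 10 * (int (d v) - 6))"
    unfolding charge_def by (simp add: sum.distrib)
  also have "\<dots> = 10 * int (\<Sum>v\<in>V. d v) - 60 * int (card V)"
    by (simp add: sum_subtractf sum_distrib_left algebra_simps)
  finally show ?thesis unfolding sum_degree by simp
qed

lemma sum_strong:
  fixes f :: "nat \<Rightarrow> int"
  shows "(\<Sum>u\<in>strong V E v. f (d u)) = (\<Sum>j=1..8. int (ns v j) * f j)"
proof -
  have "d ` strong V E v \<subseteq> {1..8}"
    using deg_pos deg_le8 unfolding strong_def nbrs_def by auto
  then have "(\<Sum>u\<in>strong V E v. f (d u)) = (\<Sum>j=1..8. \<Sum>u\<in>{u \<in> strong V E v. d u = j}. f (d u))"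
    using sum.group[OF fin_strong, of "{1..8}" d v "\<lambda>u. f (d u)"] by simp
  also have "\<dots> = (\<Sum>j=1..8. int (ns v j) * f j)"
    by (rule sum.cong) (simp_all add: ns_def)
  finally show ?thesis .
qed

lemma charge_counts:
  "charge V E v = 10 * (int (d v) - 6) + (\<Sum>j=1..8. int (ns v j) * (transfer j (d v) - transfer (d v) j))"
  unfolding charge_def using sum_strong[of "\<lambda>j. transfer j (d v) - transfer (d v) j" v] by simp

lemma sum_eight: "(\<Sum>j=1..8. f j) = f 1 + f 2 + f 3 + f 4 + f 5 + f 6 + f 7 + f (8::nat)"
  for f :: "nat \<Rightarrow> 'b::comm_monoid_add"
proof -
  have "{1..8::nat} = {1, 2, 3, 4, 5, 6, 7, 8}" by auto
  then show ?thesis by (simp add: add.assoc)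
qed

lemma card_strong: "card (strong V E v) = (\<Sum>j=1..8. ns v j)"
proof -
  have "int (card (strong V E v)) = int (\<Sum>j=1..8. ns v j)" using sum_strong[of "\<lambda>_. 1" v] by simp
  then show ?thesis by linarith
qed

section \<open>Degree constraints at edges that are not weak\<close>

lemma strong_adjacency:
  assumes "u \<in> strong V E v"
  shows "8 - int (d u) + (if d u = 8 then 1 else 0) < int (n8 v)"
    "8 - int (d v) + (if d v = 8 then 1 else 0) < int (n8 u)"
  using assms unfolding strong_def weak_edge_def x_weak_def by auto

lemma ns_pos_imp:
  assumes "0 < ns v j"
  shows "8 - int j + (if j = 8 then 1 else 0) < int (n8 v)"
proof -
  obtain u where "u \<in> strong V E v" "d u = j" using assms unfolding ns_def by (auto simp: card_gt_0_iff)
  then show ?thesis using strong_adjacency(1)[of u v] by simp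
qed

text \<open>The small strong neighbors and all 8-neighbors, strong or not, are disjoint sets of
  neighbors. The bounds therefore hold next to reducible edges as well.\<close>

lemma ns_n8_le:
  "ns v 1 + ns v 2 + ns v 3 + ns v 4 + ns v 5 + ns v 6 + ns v 7 + n8 v \<le> d v"
  "ns v 8 \<le> n8 v"
proof -
  let ?A = "{u \<in> strong V E v. d u \<noteq> 8}" and ?B = "{u \<in> N v. d u = 8}"
  have sub: "{u \<in> strong V E v. d u = 8} \<subseteq> ?B" unfolding strong_def by blast
  then show "ns v 8 \<le> n8 v" 
    unfolding ns_def num8nbrs_eq using fin_N[of v] by (intro card_mono) auto
  have "card ?A + ns v 8 = card (strong V E v)"
  proof -
    have "?A \<union> {u \<in> strong V E v. d u = 8} = strong V E v" by auto
    then have "card (strong V E v) = card (?A \<union> {u \<in> strong V E v. d u = 8})" by (rule arg_cong[OF sym])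
    also have "\<dots> = card ?A + card {u \<in> strong V E v. d u = 8}"
      using fin_strong by (intro card_Un_disjoint) auto
    finally show ?thesis unfolding ns_def by simp
  qed
  moreover have "card ?A + n8 v = card (?A \<union> ?B)"
    unfolding num8nbrs_eq using fin_strong fin_N by (intro card_Un_disjoint[symmetric]) auto
  moreover have "card (?A \<union> ?B) \<le> d v"
    unfolding degree_eq_card_nbrs[of V E v] using fin_N by (intro card_mono) (auto simp: strong_def)
  ultimately show "ns v 1 + ns v 2 + ns v 3 + ns v 4 + ns v 5 + ns v 6 + ns v 7 + n8 v \<le> d v"
    using card_strong[of v] unfolding sum_eight by linarith
qed

text \<open>A strong neighbor \<open>u\<close> has more than \<open>8 - d v\<close> neighbors of
  degree 8, and \<open>v\<close> is not among them, so \<open>d u\<close> exceeds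
  \<open>8 - d v\<close> by at least 2.\<close>

lemma ns_low_degree:
  assumes "v \<in> V" "0 < ns v j" "j \<le> 7" "d v \<le> 7"
  shows "10 \<le> d v + j"
proof -
  obtain u where u: "u \<in> strong V E v" "d u = j" using assms(2) unfolding ns_def by (auto simp: card_gt_0_iff)
  have "8 - int (d v) < int (n8 u)" using strong_adjacency(2)[OF u(1)] assms(4) by (simp split: if_splits)
  moreover have "n8 u < d u"
  proof -
    have "v \<in> N u" using u(1) assms(1) nbrs_sym unfolding strong_def by blast
    moreover have "v \<notin> {w \<in> N u. d w = 8}" using assms(4) by simp
    ultimately have "{w \<in> N u. d w = 8} \<subset> N u" by blast
    then show ?thesis unfolding num8nbrs_eq degree_eq_card_nbrs[of V E u] using fin_N psubset_card_mono by blast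
  qed
  ultimately show ?thesis using u(2) by linarith
qed

text \<open>A weak edge at \<open>v\<close> would be reducible and put \<open>v\<close> into
  \<open>D\<close>.\<close>

lemma clean_strong:
  assumes "v \<in> V" "v \<notin> D"
  shows "strong V E v = N v"
proof -
  have "\<not> weak_edge V E u v" if "u \<in> N v" for u
    using that weak_imp_reducible[of u v E V] assms unfolding reducible_ends_def nbrs_def by blast
  then show ?thesis unfolding strong_def by blast
qed

lemma clean_counts:
  assumes "v \<in> V" "v \<notin> D"
  shows "ns v 1 + ns v 2 + ns v 3 + ns v 4 + ns v 5 + ns v 6 + ns v 7 + ns v 8 = d v" "ns v 8 = n8 v"
proof -
  show "ns v 1 + ns v 2 + ns v 3 + ns v 4 + ns v 5 + ns v 6 + ns v 7 + ns v 8 = d v"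
    using card_strong[of v] clean_strong[OF assms] unfolding sum_eight degree_eq_card_nbrs[of V E v] by simp
  show "ns v 8 = n8 v" unfolding ns_def num8nbrs_eq clean_strong[OF assms] ..
qed

text \<open>The conclusion of Vizing's adjacency lemma, which holds by definition at edges that are not weak.\<close>

lemma vizing_adjacency:
  "ns v 1 = 0 \<or> 8 \<le> n8 v" "ns v 2 = 0 \<or> 7 \<le> n8 v" "ns v 3 = 0 \<or> 6 \<le> n8 v" "ns v 4 = 0 \<or> 5 \<le> n8 v"
  "ns v 5 = 0 \<or> 4 \<le> n8 v" "ns v 6 = 0 \<or> 3 \<le> n8 v" "ns v 7 = 0 \<or> 2 \<le> n8 v" "ns v 8 = 0 \<or> 2 \<le> n8 v"
proof -
  have "ns v j = 0 \<or> 9 - j \<le> n8 v" if "1 \<le> j" "j \<le> 7" for j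
    using ns_pos_imp[of v j] that by (cases "ns v j = 0") auto
  from this[of 1] this[of 2] this[of 3] this[of 4] this[of 5] this[of 6] this[of 7]
  show "ns v 1 = 0 \<or> 8 \<le> n8 v" "ns v 2 = 0 \<or> 7 \<le> n8 v" "ns v 3 = 0 \<or> 6 \<le> n8 v" "ns v 4 = 0 \<or> 5 \<le> n8 v"
    "ns v 5 = 0 \<or> 4 \<le> n8 v" "ns v 6 = 0 \<or> 3 \<le> n8 v" "ns v 7 = 0 \<or> 2 \<le> n8 v" by simp_all
  show "ns v 8 = 0 \<or> 2 \<le> n8 v" using ns_pos_imp[of v 8] by (cases "ns v 8 = 0") auto
qed

section \<open>Lower bounds for the final charge\<close>

lemma charge_by_degree:
  "d v = 4 \<Longrightarrow> charge V E v = - 20 + 6 * int (ns v 8) + 5 * int (ns v 7) + 4 * int (ns v 6)"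
  "d v = 5 \<Longrightarrow> charge V E v = - 10 + 4 * int (ns v 8) + int (ns v 7)"
  "d v = 6 \<Longrightarrow> charge V E v = 2 * int (ns v 8) - 4 * int (ns v 4)"
  "d v = 7 \<Longrightarrow> charge V E v = 10 + int (ns v 8) - 10 * int (ns v 3) - 5 * int (ns v 4) - int (ns v 5)"
  "d v = 8 \<Longrightarrow> charge V E v = 20 - 20 * int (ns v 2) - 10 * int (ns v 3) - 6 * int (ns v 4)
     - 4 * int (ns v 5) - 2 * int (ns v 6) - int (ns v 7)"
  "d v = 2 \<Longrightarrow> charge V E v = - 40 + 20 * int (ns v 8)"
  "d v = 3 \<Longrightarrow> charge V E v = - 30 + 10 * int (ns v 8) + 10 * int (ns v 7)"
  unfolding charge_counts sum_eight transfer_def by simp_all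

text \<open>Let k be the least degree from 2 to 5 of a strong neighbor. At most k - 1 strong
  neighbors have degree below 8, and each receives at most 20 / (k - 1). If there is no such k, at
  most eight gifts of at most 2 are made.\<close>

lemma charge8_nonneg:
  assumes "d v = 8"
  shows "0 \<le> charge V E v"
  unfolding charge_by_degree(5)[OF assms]
proof -
  note c = ns_n8_le(1)[of v, unfolded assms]
  consider "ns v 2 \<noteq> 0" | "ns v 2 = 0" "ns v 3 \<noteq> 0" | "ns v 2 = 0" "ns v 3 = 0" "ns v 4 \<noteq> 0"
    | "ns v 2 = 0" "ns v 3 = 0" "ns v 4 = 0" "ns v 5 \<noteq> 0"
    | "ns v 2 = 0" "ns v 3 = 0" "ns v 4 = 0" "ns v 5 = 0" by blast
  then show "0 \<le> 20 - 20 * int (ns v 2) - 10 * int (ns v 3) - 6 * int (ns v 4)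
     - 4 * int (ns v 5) - 2 * int (ns v 6) - int (ns v 7)"
  proof cases
    case 1 then show ?thesis using c vizing_adjacency(2)[of v] by linarith
  next
    case 2 then show ?thesis using c vizing_adjacency(3)[of v] by linarith
  next
    case 3 then show ?thesis using c vizing_adjacency(4)[of v] by linarith
  next
    case 4 then show ?thesis using c vizing_adjacency(5)[of v] by linarith
  next
    case 5 then show ?thesis using c by linarith
  qed
qed

text \<open>This crude bound is meant for the vertices of \<open>D\<close>. The worst estimate is at
  degree 7, where 10 units face at most seven gifts of at most 10; vertices of degree at most 5 give
  nothing.\<close>

lemma charge_ge:
  assumes "v \<in> V"
  shows "-60 \<le> charge V E v"
proof -
  consider "d v = 8" | "d v = 7" | "d v = 6" | "d v \<le> 5" using deg_le8[OF assms] by linarith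
  then show ?thesis
  proof cases
    case 1 then show ?thesis using charge8_nonneg[of v] by linarith
  next
    case 2
    then show ?thesis using ns_n8_le(1)[of v] unfolding charge_by_degree(4)[OF 2] 2 by linarith
  next
    case 3
    then show ?thesis using ns_n8_le(1)[of v] unfolding charge_by_degree(3)[OF 3] 3 by linarith
  next
    case 4
    have "0 \<le> transfer j (d v) - transfer (d v) j" for j using 4 unfolding transfer_def by auto
    then have "0 \<le> (\<Sum>j=1..8. int (ns v j) * (transfer j (d v) - transfer (d v) j))" by (intro sum_nonneg) simp
    then have "10 * (int (d v) - 6) \<le> charge V E v" unfolding charge_counts by simp
    then show ?thesis by simp
  qed
qed

text \<open>Outside \<open>D\<close> every neighbor is strong, so the counts add up to the degree
  and the adjacency inequalities settle each degree. At degrees 2 and 3 the charge is exactly zero,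
  because all neighbors have degree 8, respectively at least 7.\<close>

lemma clean_charge:
  assumes v: "v \<in> V" "v \<notin> D"
  shows "0 \<le> charge V E v" "2 \<le> n8 v" "2 \<le> d v"
    "charge V E v < 1 \<Longrightarrow> d v = 2 \<or> d v = 3 \<or> (d v = 8 \<and> (1 \<le> ns v 2 \<or> 2 \<le> ns v 3))"
proof -
  note c = clean_counts[OF v] vizing_adjacency[of v]
  have z: "ns v j = 0" if "j \<le> 7" "d v \<le> 7" "d v + j < 10" for j
    using ns_low_degree[OF v(1), of j] that by fastforce
  have pos: "1 \<le> d v" "d v \<le> 8" using deg_pos[OF v(1)] deg_le8[OF v(1)] by auto
  \<comment> \<open>Some neighbor exists, and a strong neighbor of any degree forces at least two
    8-neighbors at \<open>v\<close>.\<close>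
  show n8: "2 \<le> n8 v" using c pos by (elim disjE; linarith)
  show "2 \<le> d v" using n8 c by linarith
  then consider "d v = 2" | "d v = 3" | "d v = 4" | "d v = 5" | "d v = 6" | "d v = 7" | "d v = 8"
    using pos by linarith
  then have "0 \<le> charge V E v \<and> (charge V E v < 1 \<longrightarrow> d v = 2 \<or> d v = 3 \<or> (d v = 8 \<and> (1 \<le> ns v 2 \<or> 2 \<le> ns v 3)))"
  proof cases
    case 1
    have "ns v 1 = 0" "ns v 2 = 0" "ns v 3 = 0" "ns v 4 = 0" "ns v 5 = 0" "ns v 6 = 0" "ns v 7 = 0" using z 1 by auto
    then show ?thesis using c(1) unfolding charge_by_degree(6)[OF 1] 1 by linarith
  next
    case 2
    have "ns v 1 = 0" "ns v 2 = 0" "ns v 3 = 0" "ns v 4 = 0" "ns v 5 = 0" "ns v 6 = 0" using z 2 by auto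
    then show ?thesis using c(1) unfolding charge_by_degree(7)[OF 2] 2 by linarith
  next
    case 3
    have "ns v 1 = 0" "ns v 2 = 0" "ns v 3 = 0" "ns v 4 = 0" "ns v 5 = 0" using z 3 by auto
    then have "1 \<le> charge V E v"
      using c(1,2) n8 vizing_adjacency(6)[of v] unfolding charge_by_degree(1)[OF 3] 3 by linarith
    then show ?thesis by linarith
  next
    case 4
    have "ns v 1 = 0" "ns v 2 = 0" "ns v 3 = 0" "ns v 4 = 0" using z 4 by auto
    then have "1 \<le> charge V E v"
      using c(1,2) n8 vizing_adjacency(5,6)[of v] unfolding charge_by_degree(2)[OF 4] 4 by (elim disjE; linarith)
    then show ?thesis by linarith
  next
    case 5
    have "ns v 1 = 0" "ns v 2 = 0" "ns v 3 = 0" using z 5 by auto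
    then have "1 \<le> charge V E v"
      using c(1,2) n8 vizing_adjacency(4)[of v] unfolding charge_by_degree(3)[OF 5] 5 by (elim disjE; linarith)
    then show ?thesis by linarith
  next
    case 6
    have "ns v 1 = 0" "ns v 2 = 0" using z 6 by auto
    then have "1 \<le> charge V E v"
      using c(1,2) n8 vizing_adjacency(3-5)[of v] unfolding charge_by_degree(4)[OF 6] 6 by (elim disjE; linarith)
    then show ?thesis by linarith
  next
    case 7
    \<comment> \<open>In the four cases below at most 16, 18, 16 and 12 of the 20 units are
      spent.\<close>
    have "1 \<le> charge V E v" if "ns v 2 = 0" "ns v 3 \<le> 1"
    proof -
      note c' = that ns_n8_le(1)[of v, unfolded 7] charge_by_degree(5)[OF 7]
      consider "ns v 3 \<noteq> 0" | "ns v 3 = 0" "ns v 4 \<noteq> 0" | "ns v 3 = 0" "ns v 4 = 0" "ns v 5 \<noteq> 0"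
        | "ns v 3 = 0" "ns v 4 = 0" "ns v 5 = 0" by blast
      then show ?thesis
      proof cases
        case 1 then show ?thesis using c' vizing_adjacency(3)[of v] by linarith
      next
        case 2 then show ?thesis using c' vizing_adjacency(4)[of v] by linarith
      next
        case 3 then show ?thesis using c' vizing_adjacency(5)[of v] by linarith
      next
        case 4 then show ?thesis using c' n8 by linarith
      qed
    qed
    then have "1 \<le> charge V E v \<or> 1 \<le> ns v 2 \<or> 2 \<le> ns v 3" by linarith
    then show ?thesis using charge8_nonneg[OF 7] 7 by linarith
  qed
  then show "0 \<le> charge V E v"
    "charge V E v < 1 \<Longrightarrow> d v = 2 \<or> d v = 3 \<or> (d v = 8 \<and> (1 \<le> ns v 2 \<or> 2 \<le> ns v 3))" by auto
qed

section \<open>Bounding the number of vertices\<close>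

abbreviation "R \<equiv> {e \<in> E. reducible_edge V E e}"

definition ordinary :: "'a set" where
  "ordinary = {v \<in> V - D. 1 \<le> charge V E v}"

lemma finite_edge: "e \<in> E \<Longrightarrow> finite e"
  by (auto elim!: edge_cases)

lemma D_subset: "D \<subseteq> V"
  unfolding reducible_ends_def by blast

lemma card_D: "card D \<le> 2 * card R"
proof -
  have "finite R" using fin_E by simp
  have "D \<subseteq> (\<Union>e\<in>R. e)" unfolding reducible_ends_def by blast
  moreover have "finite (\<Union>e\<in>R. e)" using \<open>finite R\<close> finite_edge by (intro finite_UN_I) auto
  ultimately have "card D \<le> card (\<Union>e\<in>R. e)" using card_mono by blast
  also have "\<dots> \<le> (\<Sum>e\<in>R. card e)" using card_UN_le[OF \<open>finite R\<close>] .
  also have "\<dots> = (\<Sum>e\<in>R. 2)" using card_edge by (intro sum.cong) auto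
  finally show ?thesis by simp
qed

text \<open>An ordinary vertex has charge at least 1, a vertex of \<open>D\<close> at least -60 and
  any other at least 0, while five times the hypothesis bounds the total charge by
  \<open>- 5 * b\<close>.\<close>

lemma ordinary_bound:
  assumes "b + 4 * card E + 24 \<le> 12 * card V"
  shows "card ordinary + 5 * b \<le> 60 * card D"
proof -
  have fin: "finite D" using D_subset fin_V finite_subset by blast
  have "(\<Sum>v\<in>V. of_bool (v \<in> ordinary) - 60 * of_bool (v \<in> D)) \<le> (\<Sum>v\<in>V. charge V E v)"
  proof (rule sum_mono)
    fix v assume v: "v \<in> V"
    show "of_bool (v \<in> ordinary) - 60 * of_bool (v \<in> D) \<le> charge V E v"
      using charge_ge[OF v] clean_charge(1)[OF v] unfolding ordinary_def by auto
  qed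
  moreover have "(\<Sum>v\<in>V. of_bool (v \<in> ordinary)) = int (card ordinary)"
  proof -
    have "V \<inter> {v. v \<in> ordinary} = ordinary" unfolding ordinary_def by blast
    then show ?thesis using fin_V by simp
  qed
  moreover have "(\<Sum>v\<in>V. of_bool (v \<in> D)) = int (card D)"
  proof -
    have "V \<inter> {v. v \<in> D} = D" using D_subset by blast
    then show ?thesis using fin_V by simp
  qed
  ultimately have "int (card ordinary) - 60 * int (card D) \<le> 20 * int (card E) - 60 * int (card V)"
    unfolding sum_charge sum_subtractf sum_distrib_left[symmetric] by simp
  then show ?thesis using assms by linarith
qed

lemma butterfly_ends:
  assumes "butterfly_like V E x y" "{x, y} \<in> E" "x \<in> V"
  shows "x \<in> D"
  using assms unfolding reducible_ends_def reducible_edge_def by blast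

lemma obtain_three_nbrs:
  assumes "d y = 3" "v \<in> N y"
  obtains a b where "N y = {v, a, b}" "a \<noteq> b" "a \<noteq> v" "b \<noteq> v"
proof -
  have "card (N y - {v}) = 2" using assms fin_N unfolding degree_eq_card_nbrs by simp
  then obtain a b where ab: "N y - {v} = {a, b}" "a \<noteq> b" unfolding card_2_iff by blast
  show ?thesis
  proof (rule that)
    show "N y = {v, a, b}" using ab(1) assms(2) by blast
    show "a \<noteq> b" "a \<noteq> v" "b \<noteq> v" using ab by auto
  qed
qed

text \<open>A 2-neighbor of \<open>v\<close> lies in \<open>A\<close> by \<open>B2\<close>. If two
  3-neighbors \<open>y\<close>, \<open>z\<close> avoid \<open>A\<close>, their remaining neighbors
  are 8-neighbors of \<open>v\<close>. According to how these two pairs overlap, \<open>v\<close>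
  lies on a butterfly-like edge or has too few neighbors.\<close>

lemma saturated_near_defect:
  fixes B :: "'a set set"
  defines "A \<equiv> {y \<in> V. d y \<le> 3 \<and> (y \<in> D \<or> (\<exists>e\<in>B. y \<in> e))}"
  assumes B2: "\<And>y x a. N y = {x, a} \<Longrightarrow> \<exists>e\<in>B. y \<in> e"
    and B3: "\<And>y x a b. N y = {x, a, b} \<Longrightarrow> \<forall>e\<in>B. y \<notin> e \<Longrightarrow> {x, a} \<in> E \<and> {x, b} \<in> E \<and> {a, b} \<in> E"
    and B4: "\<And>x a b y z. distinct [x, a, b, y, z] \<Longrightarrow> N y = {x, a, b} \<Longrightarrow> N z = {x, a, b}
      \<Longrightarrow> \<forall>e\<in>B. y \<notin> e \<and> z \<notin> e \<Longrightarrow> N x \<subseteq> {a, b, y, z}"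
    and v: "v \<in> V" "v \<notin> D" "d v = 8" "1 \<le> ns v 2 \<or> 2 \<le> ns v 3"
  shows "\<exists>y\<in>A. v \<in> N y"
proof (rule ccontr)
  assume no: "\<not> ?thesis"
  have N_A: "y \<notin> A" if "y \<in> N v" for y using no nbrs_sym[OF that v(1)] by blast
  show False
  proof (cases "1 \<le> ns v 2")
    case True
    then obtain y where "y \<in> strong V E v" and y2: "d y = 2" unfolding ns_def by (force simp: Suc_le_eq card_gt_0_iff)
    then have y: "y \<in> N v" unfolding strong_def by simp
    obtain x a where "N y = {x, a}" using y2 unfolding degree_eq_card_nbrs card_2_iff by blast
    then have "y \<in> A" using B2 y2 nbrs_in[OF y] unfolding A_def by simp
    then show False using N_A[OF y] by simp
  next
    case False
    then have "2 \<le> card {u \<in> strong V E v. d u = 3}" using v(4) unfolding ns_def by simp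
    then obtain y z where yz: "y \<in> strong V E v" "z \<in> strong V E v" "d y = 3" "d z = 3" "y \<noteq> z"
      using card_le_Suc0_iff_eq[of "{u \<in> strong V E v. d u = 3}"] fin_strong[of v] by force
    then have nv: "y \<in> N v" "z \<in> N v" unfolding strong_def by auto
    have n8: "6 \<le> n8 v" using strong_adjacency(1)[OF yz(1)] yz(3) by simp
    \<comment> \<open>At least six 8-neighbors together with \<open>y\<close> and \<open>z\<close>
      exhaust the eight neighbors of \<open>v\<close>.\<close>
    have "{u \<in> N v. d u = 8} \<union> {y, z} = N v"
    proof (rule card_seteq)
      show "finite (N v)" by (rule fin_N)
      show "{u \<in> N v. d u = 8} \<union> {y, z} \<subseteq> N v" using nv by auto
      have "card ({u \<in> N v. d u = 8} \<union> {y, z}) = card {u \<in> N v. d u = 8} + card {y, z}"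
        using yz fin_N[of v] by (intro card_Un_disjoint) auto
      then show "card (N v) \<le> card ({u \<in> N v. d u = 8} \<union> {y, z})"
        using n8 v(3) yz(5) unfolding num8nbrs_eq degree_eq_card_nbrs[of V E v] by simp
    qed
    then have d8: "d u = 8" if "u \<in> N v" "u \<noteq> y" "u \<noteq> z" for u using that by blast
    have clean: "p \<in> V" "p \<notin> D" "\<forall>e\<in>B. p \<notin> e" "v \<in> N p" "{v, p} \<in> E"
      if "p \<in> N v" "d p = 3" for p
      using N_A[OF that(1)] nbrs_in[OF that(1)] that(2) nbrs_sym[OF that(1) v(1)]
      unfolding A_def by (auto simp: insert_commute)
    have nb8: "d w = 8 \<and> w \<in> V \<and> {p, w} \<in> E \<and> {v, w} \<in> E \<and> w \<noteq> v \<and> y \<noteq> w \<and> z \<noteq> w"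
      if p: "p = y \<or> p = z" "N p = {v, w, w'}" "w \<noteq> v" for p w w'
    proof -
      have p': "p \<in> N v" "d p = 3" using p nv yz by auto
      note cp = clean[OF p']
      have vw: "{v, w} \<in> E" using B3[OF p(2) cp(3)] by simp
      have w: "w \<in> N p" using p(2) by simp
      then have wV: "w \<in> V" "{p, w} \<in> E" "w \<noteq> p" using nbrs_in[OF w] by (auto simp: insert_commute)
      have "w \<in> N v" using vw wV(1) unfolding nbrs_def by (simp add: insert_commute)
      \<comment> \<open>A strong neighbor of degree 3 would force six 8-neighbors at the 3-vertex
        \<open>p\<close>. In particular \<open>w\<close> is neither \<open>y\<close> nor
        \<open>z\<close>.\<close>
      have "d w \<noteq> 3"
      proof
        assume "d w = 3"
        moreover have "w \<in> strong V E p" using clean_strong[OF cp(1,2)] w by simp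
        ultimately have "6 \<le> n8 p" using strong_adjacency(1)[of w p] by simp
        then show False using ns_n8_le(1)[of p] p'(2) by linarith
      qed
      then have "w \<noteq> y" "w \<noteq> z" "y \<noteq> w" "z \<noteq> w" using yz by auto
      then show ?thesis using d8[OF \<open>w \<in> N v\<close>] wV vw p(3) by simp
    qed
    obtain a b where ab: "N y = {v, a, b}" "a \<noteq> b" "a \<noteq> v" "b \<noteq> v"
      using obtain_three_nbrs[OF yz(3) clean(4)[OF nv(1) yz(3)]] .
    obtain p q where pq: "N z = {v, p, q}" "p \<noteq> q" "p \<noteq> v" "q \<noteq> v"
      using obtain_three_nbrs[OF yz(4) clean(4)[OF nv(2) yz(4)]] .
    have ab': "N y = {v, b, a}" and pq': "N z = {v, q, p}" using ab(1) pq(1) by auto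
    have vyz: "v \<noteq> y" "v \<noteq> z" "{v, y} \<in> E" "{v, z} \<in> E" "y \<in> V" "z \<in> V"
      using nbrs_in[OF nv(1)] nbrs_in[OF nv(2)] clean(5)[OF nv(1) yz(3)] clean(5)[OF nv(2) yz(4)] by auto
    have no_bf: "\<not> butterfly_like V E v y" using butterfly_ends[of v y] vyz(3) v(1,2) by blast
    \<comment> \<open>Exactly one common neighbor \<open>e\<close> besides \<open>v\<close> yields
      the form \<open>B_1\<close>, with \<open>e\<close>, \<open>g\<close>, \<open>f\<close> as
      \<open>v1\<close>, \<open>v2\<close>, \<open>v3\<close>.\<close>
    have bf1: False if "N y = {v, e, f}" "N z = {v, e, g}" "f \<noteq> g" "e \<noteq> f" "e \<noteq> g" "e \<noteq> v" "f \<noteq> v" "g \<noteq> v"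
      for e f g
    proof -
      have e: "N y = {v, f, e}" "N z = {v, g, e}" using that by auto
      note 1 = nb8[of y e f] nb8[of y f e] nb8[of z e g] nb8[of z g e]
      have "butterfly1 V E v y z e g f"
        unfolding butterfly1_def using 1 that e vyz yz v(1,3) by simp
      then show False using no_bf unfolding butterfly_like_def by blast
    qed
    \<comment> \<open>By \<open>bf1\<close>, the pairs of further neighbors of \<open>y\<close> and
      \<open>z\<close> coincide as soon as they meet.\<close>
    have "a = p \<Longrightarrow> b = q" using bf1[OF ab(1), of q] pq ab by blast
    moreover have "a = q \<Longrightarrow> b = p" using bf1[OF ab(1), of p] pq pq' ab by blast
    moreover have "b = p \<Longrightarrow> a = q" using bf1[OF ab', of q] pq ab by blast
    moreover have "b = q \<Longrightarrow> a = p" using bf1[OF ab', of p] pq pq' ab by blast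
    ultimately consider "{a, b} = {p, q}" | "a \<noteq> p" "a \<noteq> q" "b \<noteq> p" "b \<noteq> q" by blast
    then show False
    proof cases
      case 1
      \<comment> \<open>Now \<open>y\<close> and \<open>z\<close> have the same three neighbors, and
        \<open>B4\<close> leaves \<open>v\<close> at most four neighbors instead of eight.\<close>
      then have Nz: "N z = {v, a, b}" using pq(1) by simp
      have dist: "distinct [v, a, b, y, z]"
        using ab nb8[OF _ ab(1)] nb8[OF _ ab'] vyz yz(5) by auto
      have "\<forall>e\<in>B. y \<notin> e \<and> z \<notin> e"
        using clean(3)[OF nv(1) yz(3)] clean(3)[OF nv(2) yz(4)] by blast
      then have "N v \<subseteq> {a, b, y, z}" by (rule B4[OF dist ab(1) Nz])
      then have "card (N v) \<le> card {a, b, y, z}" by (intro card_mono) auto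
      also have "\<dots> \<le> 4" by (simp add: card_insert_if)
      finally show False using v(3) unfolding degree_eq_card_nbrs by simp
    next
      case 2
      \<comment> \<open>Disjoint pairs give the form \<open>B_2\<close>: \<open>y\<close> is joined
        to \<open>v1\<close>, \<open>v4\<close> and \<open>z\<close> to \<open>v2\<close>,
        \<open>v3\<close>.\<close>
      have "butterfly2 V E v y z a p q b"
        unfolding butterfly2_def
        using 2 ab pq nb8[OF _ ab(1)] nb8[OF _ ab'] nb8[OF _ pq(1)] nb8[OF _ pq'] vyz yz v(1,3) by simp
      then show False using no_bf unfolding butterfly_like_def by blast
    qed
  qed
qed

text \<open>The set \<open>P\<close> collects \<open>D\<close>, the ordinary vertices and the
  neighbors of \<open>A\<close>, and turns out to contain all 8-vertices. A remaining vertex has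
  degree 2 and lies in \<open>A\<close>, or has degree 3 and an 8-neighbor, so it is adjacent to
  \<open>P\<close>.\<close>

lemma card_V_bound:
  assumes "B \<subseteq> E"
    and B1: "card B + 4 * card E + 24 \<le> 12 * card V"
    and B2: "\<And>y x a. N y = {x, a} \<Longrightarrow> \<exists>e\<in>B. y \<in> e"
    and B3: "\<And>y x a b. N y = {x, a, b} \<Longrightarrow> \<forall>e\<in>B. y \<notin> e \<Longrightarrow> {x, a} \<in> E \<and> {x, b} \<in> E \<and> {a, b} \<in> E"
    and B4: "\<And>x a b y z. distinct [x, a, b, y, z] \<Longrightarrow> N y = {x, a, b} \<Longrightarrow> N z = {x, a, b}
      \<Longrightarrow> \<forall>e\<in>B. y \<notin> e \<and> z \<notin> e \<Longrightarrow> N x \<subseteq> {a, b, y, z}"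
  shows "card V \<le> 1460 * card R"
proof -
  define A where "A = {y \<in> V. d y \<le> 3 \<and> (y \<in> D \<or> (\<exists>e\<in>B. y \<in> e))}"
  define P where "P = D \<union> ordinary \<union> (\<Union>y\<in>A. N y)"
  have fin: "finite A" "finite D" "finite ordinary" "finite B"
    using fin_V D_subset finite_subset[OF D_subset] finite_subset[OF assms(1) fin_E]
    unfolding A_def ordinary_def by auto
  have special: "\<exists>y\<in>A. v \<in> N y" if "v \<in> V" "v \<notin> D" "d v = 8" "1 \<le> ns v 2 \<or> 2 \<le> ns v 3" for v
    unfolding A_def by (rule saturated_near_defect[OF B2 B3 B4 that])
  have eight: "v \<in> P" if "v \<in> V" "d v = 8" for v
  proof (rule ccontr)
    assume nP: "v \<notin> P"
    then have "v \<notin> D" "v \<notin> ordinary" unfolding P_def by auto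
    then have "charge V E v < 1" using that(1) unfolding ordinary_def by auto
    then have "1 \<le> ns v 2 \<or> 2 \<le> ns v 3" using clean_charge(4)[OF that(1) \<open>v \<notin> D\<close>] that(2) by simp
    then show False using special[OF that(1) \<open>v \<notin> D\<close> that(2)] nP unfolding P_def by blast
  qed
  have "V \<subseteq> A \<union> P \<union> (\<Union>p\<in>P. N p)"
  proof
    fix v assume v: "v \<in> V"
    show "v \<in> A \<union> P \<union> (\<Union>p\<in>P. N p)"
    proof (cases "v \<in> D \<or> v \<in> ordinary \<or> d v = 8")
      case True then show ?thesis using eight[OF v] unfolding P_def by blast
    next
      case False
      then have D: "v \<notin> D" by blast
      have "charge V E v < 1" using False v unfolding ordinary_def by auto
      then consider "d v = 2" | "d v = 3" using clean_charge(4)[OF v D] False by blast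
      then show ?thesis
      proof cases
        case 1
        then obtain x a where "N v = {x, a}" unfolding degree_eq_card_nbrs card_2_iff by blast
        then have "v \<in> A" using B2 1 v unfolding A_def by simp
        then show ?thesis by blast
      next
        case 2
        have "0 < card {u \<in> N v. d u = 8}" using clean_charge(2)[OF v D] unfolding num8nbrs_eq by simp
        then obtain u where u: "u \<in> N v" "d u = 8" by (auto simp: card_gt_0_iff)
        then have "u \<in> P" "v \<in> N u" using eight nbrs_in[OF u(1)] nbrs_sym[OF u(1) v] by auto
        then show ?thesis by blast
      qed
    qed
  qed
  have NV: "N p \<subseteq> V" for p unfolding nbrs_def by blast
  have PV: "P \<subseteq> V" unfolding P_def ordinary_def using D_subset NV by blast
  then have finP: "finite P" using fin_V finite_subset by blast
  have "card (\<Union>p\<in>P. N p) \<le> (\<Sum>p\<in>P. card (N p))" using card_UN_le[OF finP] .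
  also have "\<dots> \<le> (\<Sum>p\<in>P. 8)"
    using PV deg_le8 unfolding degree_eq_card_nbrs by (intro sum_mono) blast
  finally have c1: "card (\<Union>p\<in>P. N p) \<le> 8 * card P" by simp
  have "card V \<le> card (A \<union> P \<union> (\<Union>p\<in>P. N p))"
    using \<open>V \<subseteq> _\<close> fin(1) finP fin_N by (intro card_mono) auto
  also have "\<dots> \<le> card A + card P + card (\<Union>p\<in>P. N p)"
    using card_Un_le[of "A \<union> P" "\<Union>p\<in>P. N p"] card_Un_le[of A P] by linarith
  finally have c2: "card V \<le> card A + 9 * card P" using c1 by linarith
  have "card (\<Union>y\<in>A. N y) \<le> (\<Sum>y\<in>A. card (N y))" using card_UN_le[OF fin(1)] .
  also have "\<dots> \<le> (\<Sum>y\<in>A. 3)"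
    unfolding A_def degree_eq_card_nbrs by (intro sum_mono) simp
  finally have c3: "card P \<le> card D + card ordinary + 3 * card A"
    unfolding P_def using card_Un_le[of "D \<union> ordinary" "\<Union>y\<in>A. N y"] card_Un_le[of D ordinary] by simp
  have "A \<subseteq> D \<union> (\<Union>e\<in>B. e)" unfolding A_def by blast
  moreover have "finite (\<Union>e\<in>B. e)" using fin(4) assms(1) finite_edge by (intro finite_UN_I) auto
  ultimately have "card A \<le> card D + card (\<Union>e\<in>B. e)"
    using card_mono[of "D \<union> (\<Union>e\<in>B. e)" A] card_Un_le[of D "\<Union>e\<in>B. e"] fin(2) by simp
  moreover have "card (\<Union>e\<in>B. e) \<le> (\<Sum>e\<in>B. card e)" using card_UN_le[OF fin(4)] .
  moreover have "(\<Sum>e\<in>B. card e) = (\<Sum>e\<in>B. 2)" using card_edge assms(1) by (intro sum.cong) auto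
  ultimately have c4: "card A \<le> card D + 2 * card B" by simp
  \<comment> \<open>Substituting gives
    \<open>card V \<le> 37 * card D + 9 * card ordinary + 56 * card B\<close>. By
    \<open>ordinary_bound\<close> this is at most \<open>709 * card D\<close>, hence at most
    \<open>1418 * card R\<close>.\<close>
  show ?thesis using c2 c3 c4 ordinary_bound[OF B1] card_D by linarith
qed

text \<open>Without eight edges there is no vertex of degree 8, so all counts \<open>n8\<close>
  vanish, every edge is weak and \<open>D\<close> is all of \<open>V\<close>.\<close>

lemma few_edges:
  assumes "card E < 8"
  shows "card V \<le> 2 * card R"
proof -
  have lt: "d v \<noteq> 8" if "v \<in> V" for v
    using edge_incident[OF that] card_mono[OF fin_E, of "{e \<in> E. v \<in> e}"] assms by simp
  have "{u \<in> V. {u, v} \<in> E \<and> d u = 8} = {}" for v using lt by blast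
  then have n8: "n8 v = 0" for v unfolding num8nbrs_def by (simp only: card.empty)
  have "reducible_edge V E e" if e: "e \<in> E" for e
  proof -
    obtain u v where uv: "e = {u, v}" "v \<in> V" using edge_cases[OF e] by metis
    have "weak_edge V E u v" unfolding weak_edge_def x_weak_def using n8 deg_le8[OF uv(2)] by simp
    then show ?thesis using weak_imp_reducible[of u v E V] e uv(1) by simp
  qed
  moreover have "\<exists>e\<in>E. v \<in> e" if "v \<in> V" for v
  proof -
    have "0 < card {e \<in> E. v \<in> e}" using deg_pos[OF that] edge_incident[OF that] by simp
    then show ?thesis by (auto simp: card_gt_0_iff)
  qed
  ultimately have "V \<subseteq> D" unfolding reducible_ends_def by blast
  then have "V = D" using D_subset by blast
  then show ?thesis using card_D by simp
qed

end

theorem theorem2: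
  fixes V :: "'a set" and E :: "'a set set"
  assumes "simple_graph V E"
    and "planar V E"
    and "\<forall>v\<in>V. degree V E v \<ge> 1"
    and "\<forall>v\<in>V. degree V E v \<le> 8"
  shows "real (card {e \<in> E. reducible_edge V E e}) \<ge> real (card V) / 1460"
proof -
  interpret degree8_graph V E
    by unfold_locales (use assms in auto)
  have "card V \<le> 1460 * card R"
  \<comment> \<open>The facts about faces presuppose at least four edges; graphs with fewer than
    eight are settled directly.\<close>
  proof (cases "card E < 8")
    case True then show ?thesis using few_edges by linarith
  next
    case False
    then have "4 \<le> card E" by simp
    show ?thesis
      by (rule planar_defect_edges[OF assms(1,2) \<open>4 \<le> card E\<close>], rule card_V_bound)
  qed
  then have "real (card V) \<le> 1460 * real (card R)" by linarith
  then show ?thesis by simp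
qed

end
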